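(* Let $d_1,d_2\ge 3$ be integers with $d_1>d_2+4$. Then there exists $\varepsilon=\varepsilon(d_1)>0$ such that, with probability tending to $1$ as $n\to\infty$, the graph $G\sim\mathcal{G}(n,d_1,d_2)$ with true partition $(\mathcal{A},\mathcal{B})$ has the following property: for any partition $(A,B)$ of $[2n]$ with $|A\cap\mathcal{A}|>(1-\varepsilon)n$ and $|B\cap\mathcal{B}|>(1-\varepsilon)n$, if one sets $(A_0,B_0)=(A,B)$ and lets $(A_i,B_i)$ be the output of the Majority step applied to $(A_{i-1},B_{i-1})$, then $(A_t,B_t)=(\mathcal{A},\mathcal{B})$ after $t=O(\log n)$ iterations, where the constant in $O(\cdot)$ depends on $\varepsilon$ and $d_1$.
   Context: The regular stochastic block model $\mathcal{G}(n,d_1,d_2)$ is the random graph on vertex set $[2n]$ obtained as follows: choose an equipartition $(\mathcal{A},\mathcal{B})$ of $[2n]$ uniformly at random; independently choose uniformly random simple $d_1$-regular graphs on $\mathcal{A}$ and on $\mathcal{B}$; independently, connect $\mathcal{A}$ and $\mathcal{B}$ by a uniformly random simple $d_2$-regular bipartite graph. The graph is the union of these three graphs. Only $n$ with $nd_1$ even are considered. Majority step: given a partition $(A,B)$ of the vertex set (not necessarily an equipartition), let $\sigma_i=+1$ if $i\in A$ and $\sigma_i=-1$ if $i\in B$; for every vertex $i$ simultaneously set $\hat\sigma_i=\mathrm{sign}\big(\sum_{j\sim i}\sigma_j\big)$ (sum over neighbours $j$ of $i$ in $G$, with some fixed convention assigning $\mathrm{sign}(0)\in\{+1,-1\}$);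 output $A_1=\{i:\hat\sigma_i=+1\}$, $B_1=\{i:\hat\sigma_i=-1\}$. *)

theory Defs
  imports "HOL-Probability.Probability"
begin

text \<open>Vertex set [2n] is rendered as {0..<2n}. Graphs are edge sets (sets of 2-element vertex sets).\<close>

definition vertices :: "nat \<Rightarrow> nat set" where
  "vertices n = {0..<2*n}"

definition equipartitions :: "nat \<Rightarrow> nat set set" where
  "equipartitions n = {A. A \<subseteq> vertices n \<and> card A = n}"

definition degree :: "nat set set \<Rightarrow> nat \<Rightarrow> nat" where
  "degree E v = card {e \<in> E. v \<in> e}"

definition reg_graphs :: "nat set \<Rightarrow> nat \<Rightarrow> nat set set set" where
  "reg_graphs S d = {E. E \<subseteq> {e. e \<subseteq> S \<and> card e = 2} \<and> (\<forall>v\<in>S. degree E v = d)}"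

definition bip_reg_graphs :: "nat set \<Rightarrow> nat set \<Rightarrow> nat \<Rightarrow> nat set set set" where
  "bip_reg_graphs S T d = {E. E \<subseteq> {{a, b} | a b. a \<in> S \<and> b \<in> T} \<and> (\<forall>v\<in>S \<union> T. degree E v = d)}"

text \<open>The regular stochastic block model G(n,d1,d2): a distribution over pairs
  (true class \<A>, edge set of G); the true class \<B> is vertices n - \<A>.\<close>
definition SBM :: "nat \<Rightarrow> nat \<Rightarrow> nat \<Rightarrow> (nat set \<times> nat set set) pmf" where
  "SBM n d1 d2 =
     pmf_of_set (equipartitions n) \<bind> (\<lambda>A.
       pmf_of_set (reg_graphs A d1) \<bind> (\<lambda>E1.
       pmf_of_set (reg_graphs (vertices n - A) d1) \<bind> (\<lambda>E2.
       pmf_of_set (bip_reg_graphs A (vertices n - A) d2) \<bind> (\<lambda>E3.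
       return_pmf (A, E1 \<union> E2 \<union> E3)))))"

definition neighbours :: "nat set set \<Rightarrow> nat \<Rightarrow> nat set" where
  "neighbours E i = {j. {i, j} \<in> E}"

definition spin :: "nat set \<Rightarrow> nat \<Rightarrow> int" where
  "spin A j = (if j \<in> A then 1 else -1)"

text \<open>Majority step on partition (A, V - A); tie i gives the convention for sign(0) at vertex i
  (True means +1, i.e. i goes to A).\<close>
definition majority_step :: "nat set \<Rightarrow> nat set set \<Rightarrow> (nat \<Rightarrow> bool) \<Rightarrow> nat set \<Rightarrow> nat set" where
  "majority_step V E tie A =
     {i \<in> V. (\<Sum>j\<in>neighbours E i. spin A j) > 0 \<or>
             ((\<Sum>j\<in>neighbours E i. spin A j) = 0 \<and> tie i)}"

end

theory Submission
  imports Defs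
begin

text \<open>
  Given the partition, the graph is uniform among all graphs in which every vertex has \<open>d1\<close>
  neighbours on its own side and \<open>d2\<close> on the other. Exchanging two edges \<open>xy\<close>, \<open>zw\<close> for \<open>xz\<close>, \<open>yw\<close>,
  where \<open>z\<close> lies on the side of \<open>y\<close> and \<open>w\<close> on the side of \<open>x\<close>, stays in this family; counting such
  switchings shows that a fixed set of \<open>m\<close> pairs is contained in the graph with probability at most
  \<open>(4 d1\<^sup>2 / n) ^ m\<close>. By a union bound, with probability \<open>1 - O(1/n)\<close> every set \<open>U\<close> of at most \<open>\<eta> n\<close>
  vertices spans at most \<open>5/4 |U|\<close> edges.

  Since \<open>d1 - d2 \<ge> 5\<close>, a vertex misclassified after a majority step has at least three neighbours in
  the set \<open>S\<close> of vertices misclassified before it. If \<open>T\<close> is the new set of misclassified vertices,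
  then \<open>S \<union> T\<close> spans at least \<open>3 |T - S| + 3/2 |S \<inter> T|\<close> edges, and sparsity gives \<open>|T| \<le> 5/6 |S|\<close>.
  Hence the error vanishes after logarithmically many steps.
\<close>

section \<open>Switchings\<close>

definition pairs :: "'a set \<Rightarrow> 'a set set" where
  "pairs V = {e. e \<subseteq> V \<and> card e = 2}"

text \<open>The possible edge sets once the class \<open>A\<close> is fixed, gathered into one
  family. Comparing the truth values \<open>w \<in> A\<close> and \<open>v \<in> A\<close> treats
  the two classes alike, so the switching argument does not separate inner edges from crossing
  ones.\<close>

definition block_graphs :: "nat set \<Rightarrow> nat set \<Rightarrow> nat \<Rightarrow> nat \<Rightarrow> nat set set set" where
  "block_graphs V A d1 d2 = {E. E \<subseteq> pairs V \<and> (\<forall>v\<in>V.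
     card {w \<in> neighbours E v. (w \<in> A) = (v \<in> A)} = d1 \<and>
     card {w \<in> neighbours E v. (w \<in> A) \<noteq> (v \<in> A)} = d2)}"

lemma finite_pairs: "finite V \<Longrightarrow> finite (pairs V)"
  by (rule finite_subset[of _ "Pow V"]) (auto simp: pairs_def)

lemma card_pairs: "finite V \<Longrightarrow> card (pairs V) = card V choose 2"
  unfolding pairs_def by (rule n_subsets)

lemma doubleton_in_pairs [simp]: "{a, b} \<in> pairs V \<longleftrightarrow> a \<in> V \<and> b \<in> V \<and> a \<noteq> b"
  by (auto simp: pairs_def card_insert_if)

lemma finite_block_graphs: "finite V \<Longrightarrow> finite (block_graphs V A d1 d2)"
  by (rule finite_subset[of _ "Pow (pairs V)"]) (auto simp: block_graphs_def finite_pairs)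

lemma neighbours_subset: "E \<subseteq> pairs V \<Longrightarrow> neighbours E v \<subseteq> V - {v}"
proof
  fix w assume "E \<subseteq> pairs V" "w \<in> neighbours E v"
  then have "{v, w} \<in> pairs V" unfolding neighbours_def by blast
  then show "w \<in> V - {v}" by auto
qed

lemma finite_neighbours: "E \<subseteq> pairs V \<Longrightarrow> finite V \<Longrightarrow> finite (neighbours E v)"
  by (meson finite_Diff finite_subset neighbours_subset)

lemma card_ordered_pairs_le:
  assumes "finite F" "F \<subseteq> pairs V"
  shows "finite {(v, w). {v, w} \<in> F}" "card {(v, w). {v, w} \<in> F} \<le> 2 * card F"
proof -
  have fib: "finite {(v, w). {v, w} = e} \<and> card {(v, w). {v, w} = e} \<le> 2" if e: "e \<in> F" for e
  proof -
    have "card e = 2" using e assms(2) by (auto simp: pairs_def)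
    then obtain p q where pq: "e = {p, q}" by (auto simp: card_2_iff)
    have sub: "{(v, w). {v, w} = e} \<subseteq> {(p, q), (q, p)}" using pq by (auto simp: doubleton_eq_iff)
    have "card {(p, q), (q, p)} \<le> 2" using card_length[of "[(p, q), (q, p)]"] by simp
    then show ?thesis using sub card_mono[OF _ sub] finite_subset[OF sub] by force
  qed
  have eq: "{(v, w). {v, w} \<in> F} = (\<Union>e\<in>F. {(v, w). {v, w} = e})" by auto
  show "finite {(v, w). {v, w} \<in> F}" unfolding eq using assms fib by auto
  have "card (\<Union>e\<in>F. {(v, w). {v, w} = e}) \<le> (\<Sum>e\<in>F. card {(v, w). {v, w} = e})"
    by (rule card_UN_le) (use assms in auto)
  also have "\<dots> \<le> (\<Sum>e\<in>F. 2)" by (rule sum_mono) (use fib in auto)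
  finally show "card {(v, w). {v, w} \<in> F} \<le> 2 * card F" unfolding eq by simp
qed

section \<open>Exchanging two edges without changing the degrees\<close>

lemma card_Collect_swap:
  assumes "finite N" "a \<in> N" "b \<notin> N" "Q a = Q b"
  shows "card {w \<in> insert b (N - {a}). Q w} = card {w \<in> N. Q w}"
proof (cases "Q a")
  case True
  have "{w \<in> insert b (N - {a}). Q w} = insert b ({w \<in> N. Q w} - {a})"
    using True assms by auto
  also have "card \<dots> = Suc (card ({w \<in> N. Q w} - {a}))" using assms by (intro card_insert_disjoint) auto
  also have "\<dots> = card {w \<in> N. Q w}" using assms True by (intro card.remove[symmetric]) auto
  finally show ?thesis .
next
  case False
  then have "{w \<in> insert b (N - {a}). Q w} = {w \<in> N. Q w}" using assms by auto
  then show ?thesis by simp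
qed

lemma neighbours_switch:
  assumes "x \<notin> {y, z, w}"
  shows "neighbours (E - {{x, y}, {z, w}} \<union> {{x, z}, {y, w}}) x = insert z (neighbours E x - {y})"
proof (rule set_eqI)
  fix j
  have "{x, j} = {x, y} \<longleftrightarrow> j = y" "{x, j} = {x, z} \<longleftrightarrow> j = z" "{x, j} \<noteq> {z, w}" "{x, j} \<noteq> {y, w}"
    using assms by (auto simp: doubleton_eq_iff)
  then show "j \<in> neighbours (E - {{x, y}, {z, w}} \<union> {{x, z}, {y, w}}) x \<longleftrightarrow> j \<in> insert z (neighbours E x - {y})"
    by (simp add: neighbours_def)
qed

text \<open>Each endpoint trades one neighbour for another on the same side: \<open>x\<close> trades
  \<open>y\<close> for \<open>z\<close>, \<open>y\<close> trades \<open>x\<close> for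
  \<open>w\<close>, \<open>z\<close> trades \<open>w\<close> for \<open>x\<close>, and
  \<open>w\<close> trades \<open>z\<close> for \<open>y\<close>. All other neighbourhoods are
  untouched, so both degrees of every vertex survive.\<close>

lemma switching_in_block_graphs:
  assumes E: "E \<in> block_graphs V A d1 d2" and V: "finite V"
    and xy: "{x, y} \<in> E" and zw: "{z, w} \<in> E" and dist: "distinct [x, y, z, w]"
    and xz: "{x, z} \<notin> E" and yw: "{y, w} \<notin> E"
    and sides: "(z \<in> A) = (y \<in> A)" "(w \<in> A) = (x \<in> A)"
  shows "E - {{x, y}, {z, w}} \<union> {{x, z}, {y, w}} \<in> block_graphs V A d1 d2"
proof -
  define E' where "E' = E - {{x, y}, {z, w}} \<union> {{x, z}, {y, w}}"
  have EV: "E \<subseteq> pairs V" using E by (simp add: block_graphs_def)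
  have "{x, y} \<in> pairs V" "{z, w} \<in> pairs V" using EV xy zw by blast+
  then have inV: "x \<in> V" "y \<in> V" "z \<in> V" "w \<in> V" by auto
  have E'V: "E' \<subseteq> pairs V" using EV inV dist by (auto simp: E'_def)
  have nx: "neighbours E' x = insert z (neighbours E x - {y})"
    using neighbours_switch[of x y z w E] dist by (simp add: E'_def)
  have ny: "neighbours E' y = insert w (neighbours E y - {x})"
    using neighbours_switch[of y x w z E] dist by (simp add: E'_def insert_commute)
  have nz: "neighbours E' z = insert x (neighbours E z - {w})"
    using neighbours_switch[of z w x y E] dist by (simp add: E'_def insert_commute)
  have nw: "neighbours E' w = insert y (neighbours E w - {z})"
    using neighbours_switch[of w z y x E] dist by (simp add: E'_def insert_commute)
  have no: "neighbours E' v = neighbours E v" if "v \<notin> {x, y, z, w}" for v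
  proof -
    have "{v, j} \<notin> {{x, y}, {z, w}, {x, z}, {y, w}}" for j using that by (auto simp: doubleton_eq_iff)
    then show ?thesis by (auto simp: neighbours_def E'_def)
  qed
  have fin: "finite (neighbours E v)" for v using EV V finite_neighbours by blast
  have mem: "y \<in> neighbours E x" "x \<in> neighbours E y" "w \<in> neighbours E z" "z \<in> neighbours E w"
    "z \<notin> neighbours E x" "w \<notin> neighbours E y" "x \<notin> neighbours E z" "y \<notin> neighbours E w"
    using xy zw xz yw by (auto simp: neighbours_def insert_commute)
  \<comment> \<open>With \<open>Q\<close> an arbitrary predicate on a truth value, one statement
    covers the own-side and the other-side degree.\<close>
  have same: "card {u \<in> neighbours E' v. Q (u \<in> A)} = card {u \<in> neighbours E v. Q (u \<in> A)}" for v Q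
  proof -
    consider "v = x" | "v = y" | "v = z" | "v = w" | "v \<notin> {x, y, z, w}" by blast
    then show ?thesis
    proof cases
      case 1 show ?thesis unfolding 1 nx by (rule card_Collect_swap) (use fin mem sides in auto)
    next
      case 2 show ?thesis unfolding 2 ny by (rule card_Collect_swap) (use fin mem sides in auto)
    next
      case 3 show ?thesis unfolding 3 nz by (rule card_Collect_swap) (use fin mem sides in auto)
    next
      case 4 show ?thesis unfolding 4 nw by (rule card_Collect_swap) (use fin mem sides in auto)
    next
      case 5 then show ?thesis by (simp add: no)
    qed
  qed
  have "E' \<in> block_graphs V A d1 d2"
    using E E'V same[of v "\<lambda>b. b = (v \<in> A)" for v] same[of v "\<lambda>b. b \<noteq> (v \<in> A)" for v]
    by (auto simp: block_graphs_def)
  then show ?thesis by (simp add: E'_def)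
qed

section \<open>Counting graphs that contain prescribed edges\<close>

lemma card_neighbours_block:
  assumes "E \<in> block_graphs V A d1 d2" "finite V" "v \<in> V"
  shows "card (neighbours E v) = d1 + d2"
proof -
  have "finite (neighbours E v)" using assms finite_neighbours by (auto simp: block_graphs_def)
  moreover have "neighbours E v = {w \<in> neighbours E v. (w \<in> A) = (v \<in> A)} \<union> {w \<in> neighbours E v. (w \<in> A) \<noteq> (v \<in> A)}"
    by auto
  ultimately have "card (neighbours E v) = card {w \<in> neighbours E v. (w \<in> A) = (v \<in> A)} + card {w \<in> neighbours E v. (w \<in> A) \<noteq> (v \<in> A)}"
    by (subst card_Un_disjoint[symmetric]) auto
  then show ?thesis using assms by (simp add: block_graphs_def)
qed

text \<open>Double counting of switchings that destroy \<open>e\<close> and keep \<open>F\<close>.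
  Every graph containing both admits at least \<open>n\<close> of them. The result still contains
  \<open>F\<close>, and together with \<open>(z, w)\<close> it determines the original; there
  \<open>z\<close> is a neighbour of \<open>x\<close> and \<open>w\<close> one of \<open>y\<close>,
  which leaves at most \<open>(2 * d1) ^ 2\<close> choices per resulting graph.\<close>

lemma switching_ratio:
  assumes V: "finite V" and A: "A \<subseteq> V" "card A = n" "card (V - A) = n"
    and d: "3 \<le> d2" "d2 \<le> d1" and n: "n \<ge> 4 * d1 * (2 * d1 + 1)"
    and F: "2 * card F \<le> n" "F \<subseteq> pairs V" and e: "e \<in> pairs V" "e \<notin> F"
  shows "card {E \<in> block_graphs V A d1 d2. insert e F \<subseteq> E} * n
       \<le> 4 * d1\<^sup>2 * card {E \<in> block_graphs V A d1 d2. F \<subseteq> E}"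
proof -
  let ?G = "block_graphs V A d1 d2"
  let ?X = "{E \<in> ?G. insert e F \<subseteq> E}" and ?Y = "{E \<in> ?G. F \<subseteq> E}"
  obtain x y where exy: "e = {x, y}" using e by (auto simp: pairs_def card_2_iff)
  have xyV: "x \<in> V" "y \<in> V" "x \<noteq> y" using e exy by auto
  have finG: "finite ?G" using V by (rule finite_block_graphs)
  have finY: "finite ?Y" using finG by simp
  have fNY: "finite (neighbours E v)" if "E \<in> ?Y" for E v
    using that by (intro finite_neighbours[OF _ V]) (simp add: block_graphs_def)
  \<comment> \<open>The oriented edges that can be switched with \<open>e\<close>: sides match, the
    removed edge lies outside \<open>F\<close>, and the two inserted edges are new.\<close>
  define W where "W E = {(z, w). {z, w} \<in> E \<and> {z, w} \<notin> F \<and> (z \<in> A) = (y \<in> A) \<and> (w \<in> A) = (x \<in> A)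
      \<and> z \<noteq> x \<and> w \<noteq> y \<and> {x, z} \<notin> E \<and> {y, w} \<notin> E}" for E
  have finF: "finite F" using F(2) V finite_pairs finite_subset by blast
  have finW: "finite (W E)" if "E \<in> ?G" for E
  proof -
    have "E \<subseteq> pairs V" using that by (simp add: block_graphs_def)
    then have "finite E" using V finite_pairs finite_subset by blast
    then have "finite {(z, w). {z, w} \<in> E}" using card_ordered_pairs_le(1) \<open>E \<subseteq> pairs V\<close> by blast
    then show ?thesis by (rule finite_subset[rotated]) (auto simp: W_def)
  qed
  \<comment> \<open>There are \<open>n\<close> choices of \<open>w\<close> on the side of
    \<open>x\<close>, each with at least three neighbours \<open>z\<close> on the side of
    \<open>y\<close>, since \<open>d1\<close> and \<open>d2\<close> are at least 3. Of these
    \<open>3 * n\<close> pairs at most \<open>2 * card F\<close>, hence at most \<open>n\<close>,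
    lie in \<open>F\<close>, and at most \<open>4 * d1 * (2 * d1 + 1)\<close>, hence at most
    \<open>n\<close>, have \<open>z\<close> equal or adjacent to \<open>x\<close> or
    \<open>w\<close> equal or adjacent to \<open>y\<close>.\<close>
  have cardW: "card (W E) \<ge> n" if E: "E \<in> ?X" for E
  proof -
    have EG: "E \<in> ?G" and EV: "E \<subseteq> pairs V" using E by (auto simp: block_graphs_def)
    have fN: "finite (neighbours E v)" for v using EV V finite_neighbours by blast
    have cN: "card (neighbours E v) \<le> 2 * d1" if "v \<in> V" for v
      using card_neighbours_block[OF EG V that] d by simp
    define T where "T = (SIGMA w:{w \<in> V. (w \<in> A) = (x \<in> A)}. {z \<in> neighbours E w. (z \<in> A) = (y \<in> A)})"
    have cs: "card {z \<in> neighbours E w. (z \<in> A) = (y \<in> A)} \<ge> 3" if "w \<in> V" "(w \<in> A) = (x \<in> A)" for w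
    proof (cases "(w \<in> A) = (y \<in> A)")
      case True
      then have "{z \<in> neighbours E w. (z \<in> A) = (y \<in> A)} = {z \<in> neighbours E w. (z \<in> A) = (w \<in> A)}" by auto
      then have "card {z \<in> neighbours E w. (z \<in> A) = (y \<in> A)} = d1" using EG that(1) by (simp add: block_graphs_def)
      then show ?thesis using d by simp
    next
      case False
      then have "{z \<in> neighbours E w. (z \<in> A) = (y \<in> A)} = {z \<in> neighbours E w. (z \<in> A) \<noteq> (w \<in> A)}" by auto
      then have "card {z \<in> neighbours E w. (z \<in> A) = (y \<in> A)} = d2" using EG that(1) by (simp add: block_graphs_def)
      then show ?thesis using d by simp
    qed
    have cI: "card {w \<in> V. (w \<in> A) = (x \<in> A)} = n"
    proof (cases "x \<in> A")
      case True
      then have "{w \<in> V. (w \<in> A) = (x \<in> A)} = A" using A by auto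
      then show ?thesis using A by simp
    next
      case False
      then have "{w \<in> V. (w \<in> A) = (x \<in> A)} = V - A" by auto
      then show ?thesis using A by simp
    qed
    have "card T = (\<Sum>w\<in>{w \<in> V. (w \<in> A) = (x \<in> A)}. card {z \<in> neighbours E w. (z \<in> A) = (y \<in> A)})"
      unfolding T_def by (rule card_SigmaI) (use V fN in auto)
    also have "\<dots> \<ge> (\<Sum>w\<in>{w \<in> V. (w \<in> A) = (x \<in> A)}. 3)"
      by (rule sum_mono) (use cs in auto)
    finally have cT: "card T \<ge> 3 * n" using cI by simp
    define B1 where "B1 = {(w, z). {w, z} \<in> F}"
    define B2 where "B2 = (SIGMA z:insert x (neighbours E x). neighbours E z)"
    define B3 where "B3 = (SIGMA w:insert y (neighbours E y). neighbours E w)"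
    have b1: "finite B1" "card B1 \<le> 2 * card F" using card_ordered_pairs_le[OF finF F(2)] by (auto simp: B1_def)
    have bb: "finite (SIGMA z:insert v (neighbours E v). neighbours E z) \<and>
        card (SIGMA z:insert v (neighbours E v). neighbours E z) \<le> (2 * d1 + 1) * (2 * d1)" if "v \<in> V" for v
    proof -
      have sub: "insert v (neighbours E v) \<subseteq> V" using that neighbours_subset[OF EV] by blast
      have "card (SIGMA z:insert v (neighbours E v). neighbours E z) = (\<Sum>z\<in>insert v (neighbours E v). card (neighbours E z))"
        by (rule card_SigmaI) (use fN in auto)
      also have "\<dots> \<le> (\<Sum>z\<in>insert v (neighbours E v). 2 * d1)"
        by (rule sum_mono) (use cN sub in blast)
      also have "\<dots> = card (insert v (neighbours E v)) * (2 * d1)" by simp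
      also have "\<dots> \<le> (2 * d1 + 1) * (2 * d1)"
        by (rule mult_le_mono1) (use cN[OF that] fN[of v] in \<open>auto simp: card_insert_if\<close>)
      finally show ?thesis using fN by auto
    qed
    have b2: "finite B2" "card B2 \<le> (2 * d1 + 1) * (2 * d1)" using bb xyV by (auto simp: B2_def)
    have b3: "finite B3" "card B3 \<le> (2 * d1 + 1) * (2 * d1)" using bb xyV by (auto simp: B3_def)
    \<comment> \<open>\<open>T\<close>, \<open>B1\<close> and \<open>B3\<close> list a pair as
      \<open>(w, z)\<close>, whereas \<open>W\<close> and \<open>B2\<close> list it as
      \<open>(z, w)\<close>.\<close>
    have "T \<subseteq> prod.swap ` W E \<union> B1 \<union> prod.swap ` B2 \<union> B3"
    proof
      fix p assume "p \<in> T"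
      then obtain w z where p: "p = (w, z)" and wz: "w \<in> V" "(w \<in> A) = (x \<in> A)" "z \<in> neighbours E w" "(z \<in> A) = (y \<in> A)"
        by (auto simp: T_def)
      have zw: "{z, w} \<in> E" "w \<in> neighbours E z" using wz by (auto simp: neighbours_def insert_commute)
      show "p \<in> prod.swap ` W E \<union> B1 \<union> prod.swap ` B2 \<union> B3"
      proof (cases "(z, w) \<in> W E")
        case True then show ?thesis using p by force
      next
        case False
        then consider "{w, z} \<in> F" | "z \<in> insert x (neighbours E x)" | "w \<in> insert y (neighbours E y)"
          using zw wz by (auto simp: W_def neighbours_def insert_commute)
        then show ?thesis
        proof cases
          case 1 then show ?thesis using p by (simp add: B1_def)
        next
          case 2 then have "(z, w) \<in> B2" using zw by (simp add: B2_def)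
          then show ?thesis using p by force
        next
          case 3 then have "(w, z) \<in> B3" using wz by (simp add: B3_def)
          then show ?thesis using p by simp
        qed
      qed
    qed
    then have "card T \<le> card (prod.swap ` W E \<union> B1 \<union> prod.swap ` B2 \<union> B3)"
      by (rule card_mono[rotated]) (use finW EG b1 b2 b3 in auto)
    also have "\<dots> \<le> card (prod.swap ` W E) + card B1 + card (prod.swap ` B2) + card B3"
      by (meson add_mono card_Un_le le_trans order_refl)
    also have "\<dots> = card (W E) + card B1 + card B2 + card B3"
      by (simp add: card_image)
    also have "\<dots> \<le> card (W E) + 2 * card F + (2 * d1 + 1) * (2 * d1) + (2 * d1 + 1) * (2 * d1)"
      using b1 b2 b3 by linarith
    finally have "3 * n \<le> card (W E) + 2 * card F + 4 * d1 * (2 * d1 + 1)" using cT by (simp add: algebra_simps)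
    then show ?thesis using F(1) n by linarith
  qed
  define \<Phi> where "\<Phi> = (\<lambda>(E, z, w). (E - {{x, y}, {z, w}} \<union> {{x, z}, {y, w}}, z, w))"
  let ?P = "SIGMA E:?X. W E"
  let ?Q = "SIGMA E:?Y. neighbours E x \<times> neighbours E y"
  \<comment> \<open>The cases \<open>z = y\<close> and \<open>w = x\<close> are excluded because
    \<open>{x, y}\<close> is an edge while \<open>{x, z}\<close> and \<open>{y, w}\<close> are not;
    \<open>z = w\<close> is excluded because edges have two elements.\<close>
  have Wd: "distinct [x, y, z, w]" if "E \<in> ?X" "(z, w) \<in> W E" for E z w
  proof -
    have "{x, y} \<in> E" "{z, w} \<in> E" "E \<subseteq> pairs V" using that exy by (auto simp: block_graphs_def W_def)
    moreover from this have "{z, w} \<in> pairs V" by blast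
    ultimately show ?thesis using that(2) xyV by (auto simp: W_def insert_commute)
  qed
  \<comment> \<open>With \<open>z\<close> and \<open>w\<close> recorded, undoing the switch recovers
    the graph: the inserted edges were absent before and the removed ones present.\<close>
  have "inj_on \<Phi> ?P"
  proof (rule inj_onI)
    fix p q assume p: "p \<in> ?P" and q: "q \<in> ?P" and eq: "\<Phi> p = \<Phi> q"
    obtain E z w where pe: "p = (E, z, w)" by (cases p)
    obtain E' where qe: "q = (E', z, w)" using eq pe by (cases q) (auto simp: \<Phi>_def)
    have eqE: "E - {{x, y}, {z, w}} \<union> {{x, z}, {y, w}} = E' - {{x, y}, {z, w}} \<union> {{x, z}, {y, w}}"
      using eq pe qe by (simp add: \<Phi>_def)
    have "{x, y} \<in> E" "{x, y} \<in> E'" "{z, w} \<in> E" "{z, w} \<in> E'" "{x, z} \<notin> E" "{y, w} \<notin> E" "{x, z} \<notin> E'" "{y, w} \<notin> E'"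
      using p q pe qe exy by (auto simp: W_def)
    then have "E = E'" using eqE by blast
    then show "p = q" using pe qe by simp
  qed
  moreover have "\<Phi> ` ?P \<subseteq> ?Q"
  proof
    fix r assume "r \<in> \<Phi> ` ?P"
    then obtain E z w where r: "r = \<Phi> (E, z, w)" and E: "E \<in> ?X" and zw: "(z, w) \<in> W E" by auto
    let ?E' = "E - {{x, y}, {z, w}} \<union> {{x, z}, {y, w}}"
    have "?E' \<in> ?G"
      by (rule switching_in_block_graphs[OF _ V]) (use E zw Wd[OF E zw] exy in \<open>auto simp: W_def\<close>)
    moreover have "F \<subseteq> ?E'" using E zw e exy by (auto simp: W_def)
    moreover have "z \<in> neighbours ?E' x" "w \<in> neighbours ?E' y" by (auto simp: neighbours_def)
    ultimately show "r \<in> ?Q" unfolding r by (simp add: \<Phi>_def)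
  qed
  moreover have "finite ?Q"
    by (intro finite_SigmaI finite_cartesian_product finY fNY)
  ultimately have "card ?P \<le> card ?Q" by (rule card_inj_on_le)
  moreover have "card ?P \<ge> card ?X * n"
  proof -
    have "card ?X * n = (\<Sum>E\<in>?X. n)" by simp
    also have "\<dots> \<le> (\<Sum>E\<in>?X. card (W E))" by (rule sum_mono) (use cardW in auto)
    also have "\<dots> = card ?P" by (rule card_SigmaI[symmetric]) (use finG finW in auto)
    finally show ?thesis .
  qed
  moreover have "card ?Q \<le> card ?Y * (4 * d1\<^sup>2)"
  proof -
    have le: "card (neighbours E x \<times> neighbours E y) \<le> 4 * d1\<^sup>2" if "E \<in> ?Y" for E
    proof -
      have "card (neighbours E x) \<le> 2 * d1" "card (neighbours E y) \<le> 2 * d1"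
        using that card_neighbours_block[OF _ V] xyV d by auto
      then have "card (neighbours E x) * card (neighbours E y) \<le> (2 * d1) * (2 * d1)" by (rule mult_le_mono)
      then show ?thesis by (simp add: card_cartesian_product power2_eq_square)
    qed
    have "card ?Q = (\<Sum>E\<in>?Y. card (neighbours E x \<times> neighbours E y))"
      by (rule card_SigmaI) (use finY fNY in blast)+
    also have "\<dots> \<le> (\<Sum>E\<in>?Y. 4 * d1\<^sup>2)" by (rule sum_mono) (use le in auto)
    finally show ?thesis by simp
  qed
  ultimately show ?thesis by (simp add: mult.commute)
qed

text \<open>The prescribed edges are imposed one at a time, and each costs a factor
  \<open>4 * d1\<^sup>2 / n\<close> by the switching ratio. The bound is stated without
  division.\<close>

lemma card_containing_le:
  assumes V: "finite V" and A: "A \<subseteq> V" "card A = n" "card (V - A) = n"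
    and d: "3 \<le> d2" "d2 \<le> d1" and n: "n \<ge> 4 * d1 * (2 * d1 + 1)"
    and F: "2 * card F \<le> n" "F \<subseteq> pairs V"
  shows "card {E \<in> block_graphs V A d1 d2. F \<subseteq> E} * n ^ card F
       \<le> (4 * d1\<^sup>2) ^ card F * card (block_graphs V A d1 d2)"
proof -
  have "finite F" using F(2) V finite_pairs finite_subset by blast
  then show ?thesis using F
  proof (induction F)
    case empty then show ?case by simp
  next
    case (insert e F)
    let ?N = "\<lambda>F. card {E \<in> block_graphs V A d1 d2. F \<subseteq> E}"
    have "?N (insert e F) * n ^ card (insert e F) = (?N (insert e F) * n) * n ^ card F"
      using insert by simp
    also have "\<dots> \<le> (4 * d1\<^sup>2 * ?N F) * n ^ card F"
      by (rule mult_le_mono1, rule switching_ratio) (use insert assms in auto)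
    also have "\<dots> = 4 * d1\<^sup>2 * (?N F * n ^ card F)" by simp
    also have "\<dots> \<le> 4 * d1\<^sup>2 * ((4 * d1\<^sup>2) ^ card F * card (block_graphs V A d1 d2))"
      by (rule mult_le_mono2) (use insert in auto)
    finally show ?case using insert by (simp add: mult.assoc)
  qed
qed

section \<open>Local sparsity\<close>

text \<open>The number \<open>k ^ k / fact k\<close> is a single term of the series for
  \<open>exp k\<close>, so \<open>fact k\<close> is at least \<open>(k / e) ^ k\<close>, and
  \<open>e\<close> is at most 3.\<close>

lemma binomial_le_three_pow:
  assumes "k > 0"
  shows "real (N choose k) \<le> (3 * real N / real k) ^ k"
proof -
  have "real k ^ k / fact k \<le> exp (real k)"
  proof -
    have "(\<lambda>n. real k ^ n /\<^sub>R fact n) sums exp (real k)" by (rule exp_converges)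
    then have "(\<lambda>n. real k ^ n / fact n) sums exp (real k)" by (simp add: divide_inverse mult.commute)
    then have "(\<Sum>n\<in>{k}. real k ^ n / fact n) \<le> exp (real k)"
      by (metis (mono_tags, lifting) sum_le_suminf sums_iff finite.intros divide_nonneg_nonneg fact_ge_zero of_nat_0_le_iff zero_le_power)
    then show ?thesis by simp
  qed
  also have "exp (real k) = exp 1 ^ k" by (simp add: exp_of_nat_mult[symmetric])
  also have "\<dots> \<le> 3 ^ k" by (rule power_mono) (use exp_le in auto)
  finally have kf: "real k ^ k \<le> 3 ^ k * fact k" by (simp add: field_simps)
  have "real (N choose k) * fact k \<le> real N ^ k"
    using binomial_fact_pow[of N k] by (metis of_nat_fact of_nat_le_iff of_nat_mult of_nat_power)
  then have "real (N choose k) * (3 ^ k * fact k) \<le> (3 * real N) ^ k"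
    by (simp add: power_mult_distrib mult.left_commute mult_left_mono)
  then have "real (N choose k) * real k ^ k \<le> (3 * real N) ^ k"
    using mult_left_mono[OF kf, of "real (N choose k)"] by linarith
  then show ?thesis using assms by (simp add: power_divide field_simps)
qed

text \<open>The three factors count the vertex sets of size \<open>u\<close>, count the choices of
  \<open>u + q\<close> pairs inside one, where \<open>q = u div 4 + 1\<close>, and bound the
  probability that all these pairs are edges. In the \<open>u\<close>-th powers \<open>n\<close> and
  \<open>u\<close> cancel and only \<open>12 * c\<close> remains; the \<open>q\<close> surplus edges
  supply powers of \<open>u / n\<close>.\<close>

lemma union_bound_term:
  fixes c :: real
  assumes c: "c \<ge> 1" and n: "n > 0" and u: "u > 0"
    and small: "(12 * c) ^ 4 * (2 * c) * real u / real n \<le> 1 / 256"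
  shows "real (2 * n choose u) * real ((u choose 2) choose (u + u div 4 + 1)) * (c / real n) ^ (u + u div 4 + 1)
       \<le> (12 * c) ^ 4 * (2 * c) * 64 / real n / 2 ^ u"
proof -
  define q where "q = u div 4 + 1"
  define L where "L = (12 * c) ^ 4 * (2 * c)"
  have m: "u + u div 4 + 1 = u + q" by (simp add: q_def)
  have "real (2 * n choose u) \<le> (3 * real (2 * n) / real u) ^ u" by (rule binomial_le_three_pow[OF u])
  also have "\<dots> = (6 * real n / real u) ^ u" by simp
  finally have b1: "real (2 * n choose u) \<le> (6 * real n / real u) ^ u" .
  have "real ((u choose 2) choose (u + q)) \<le> (3 * real (u choose 2) / real (u + q)) ^ (u + q)"
    by (rule binomial_le_three_pow) (use u in simp)
  also have "\<dots> \<le> (2 * real u) ^ (u + q)"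
  proof (rule power_mono)
    have "3 * real (u choose 2) \<le> 3 / 2 * (real u * real u)"
    proof -
      have "2 * (u choose 2) \<le> u * (u - 1)" unfolding choose_two by simp
      also have "\<dots> \<le> u * u" by simp
      finally have "2 * (u choose 2) \<le> u * u" .
      then have "2 * real (u choose 2) \<le> real u * real u"
        by (metis of_nat_le_iff of_nat_mult of_nat_numeral)
      then show ?thesis by simp
    qed
    also have "\<dots> \<le> 2 * real u * real (u + q)" by (simp add: algebra_simps)
    finally show "3 * real (u choose 2) / real (u + q) \<le> 2 * real u" using u by (simp add: field_simps)
  qed simp
  finally have b2: "real ((u choose 2) choose (u + q)) \<le> (2 * real u) ^ (u + q)" .
  have "real (2 * n choose u) * real ((u choose 2) choose (u + q)) * (c / real n) ^ (u + q)
     \<le> (6 * real n / real u) ^ u * (2 * real u) ^ (u + q) * (c / real n) ^ (u + q)"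
    using b1 b2 c by (intro mult_mono) auto
  also have "\<dots> = (6 * real n / real u * (2 * real u) * (c / real n)) ^ u * (2 * real u * (c / real n)) ^ q"
    by (simp only: power_add power_mult_distrib) (simp only: mult.assoc mult.left_commute mult.commute)
  also have "6 * real n / real u * (2 * real u) * (c / real n) = 12 * c" using n u by simp
  \<comment> \<open>Since \<open>u \<le> 4 * q\<close>, the factor \<open>(12 * c) ^ u\<close> can
    be absorbed into the \<open>q\<close>-th power.\<close>
  also have "(12 * c) ^ u * (2 * real u * (c / real n)) ^ q \<le> (12 * c) ^ (4 * q) * (2 * real u * (c / real n)) ^ q"
    using c by (intro mult_right_mono power_increasing) (auto simp: q_def)
  also have "\<dots> = (L * real u / real n) ^ q"
    unfolding power_mult power_mult_distrib[symmetric] L_def by (simp add: mult_ac)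
  \<comment> \<open>One factor is set aside to supply the \<open>1 / n\<close>; the other
    \<open>u div 4\<close> factors are at most \<open>1 / 256\<close> and give the geometric
    decay.\<close>
  also have "\<dots> = (L * real u / real n) * (L * real u / real n) ^ (u div 4)" by (simp add: q_def)
  also have "\<dots> \<le> (L * real u / real n) * (64 * (1 / 4) ^ u)"
  proof (rule mult_left_mono)
    have "(L * real u / real n) ^ (u div 4) \<le> (1 / 256) ^ (u div 4)"
      using small c by (intro power_mono) (auto simp: L_def)
    also have "\<dots> = (1 / 4) ^ (4 * (u div 4))" by (simp add: power_mult power_divide)
    \<comment> \<open>The constant \<open>64 = 4 ^ 3\<close> pays for the remainder of
      \<open>u\<close> modulo 4, which is at most 3.\<close>
    also have "\<dots> = 64 * (1 / 4) ^ (4 * (u div 4) + 3)" by (simp add: power_add power_one_over power3_eq_cube)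
    also have "\<dots> \<le> 64 * (1 / 4) ^ u" by (intro mult_left_mono power_decreasing) auto
    finally show "(L * real u / real n) ^ (u div 4) \<le> 64 * (1 / 4) ^ u" .
  qed (use c in \<open>simp add: L_def\<close>)
  \<comment> \<open>Splitting \<open>4 ^ u\<close> as \<open>2 ^ u * 2 ^ u\<close> lets one half
    absorb the factor \<open>u\<close> and keeps the other summable.\<close>
  also have "\<dots> = L * 64 / real n / 2 ^ u * (real u / 2 ^ u)"
  proof -
    have "(4::real) ^ u = 2 ^ u * 2 ^ u" by (simp flip: power_mult_distrib)
    then show ?thesis by (simp add: power_one_over mult_ac)
  qed
  also have "\<dots> \<le> L * 64 / real n / 2 ^ u * 1"
  proof (rule mult_left_mono)
    have "real u \<le> 2 ^ u" using less_exp[of u] by (metis of_nat_less_numeral_power_cancel_iff less_imp_le)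
    then show "real u / 2 ^ u \<le> 1" by simp
  qed (use c in \<open>simp add: L_def\<close>)
  finally show ?thesis unfolding m L_def by simp
qed

section \<open>Counting graphs that have a small dense vertex set\<close>

lemma real_card_UN_le:
  "finite I \<Longrightarrow> real (card (\<Union>i\<in>I. X i)) \<le> (\<Sum>i\<in>I. real (card (X i)))"
  using of_nat_mono[OF card_UN_le[of I X], where 'a = real] by simp

text \<open>The threshold of the union bound at \<open>c = 4 * d^2\<close>: for \<open>u\<close> up
  to this multiple of \<open>n\<close>, the factor raised to the power \<open>u div 4\<close> is at
  most \<open>1 / 256\<close>.\<close>

definition sparsity_radius :: "nat \<Rightarrow> real" where
  "sparsity_radius d = 1 / (256 * ((12 * (4 * real d ^ 2)) ^ 4 * (2 * (4 * real d ^ 2))))"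

text \<open>A dense set \<open>U\<close> of size \<open>u\<close> spans
  \<open>u + u div 4 + 1\<close> edges, the least integer above \<open>5 * u / 4\<close>. A union
  over \<open>u\<close>, \<open>U\<close> and the choice of that many pairs inside \<open>U\<close>
  therefore covers all bad graphs, and the terms decay geometrically in \<open>u\<close>.\<close>

lemma card_dense_le:
  fixes d1 :: nat
  defines "\<eta> \<equiv> sparsity_radius d1"
  assumes V: "finite V" and A: "A \<subseteq> V" "card A = n" "card (V - A) = n"
    and d: "3 \<le> d2" "d2 \<le> d1" and n: "n \<ge> 4 * d1 * (2 * d1 + 1)"
  shows "real (card {E \<in> block_graphs V A d1 d2. \<exists>U\<subseteq>V. U \<noteq> {} \<and> real (card U) \<le> \<eta> * real n
                \<and> 5 * card U < 4 * card {e \<in> E. e \<subseteq> U}})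
       \<le> (1 / (4 * \<eta>)) / real n * real (card (block_graphs V A d1 d2))"
proof -
  let ?G = "block_graphs V A d1 d2"
  define c where "c = 4 * real d1 ^ 2"
  define L where "L = (12 * c) ^ 4 * (2 * c)"
  define m where "m = (\<lambda>u::nat. u + u div 4 + 1)"
  define M where "M = nat \<lfloor>\<eta> * real n\<rfloor>"
  define \<U> where "\<U> = (\<lambda>u. {U. U \<subseteq> V \<and> card U = u})"
  define \<F> where "\<F> = (\<lambda>U::nat set. {F. F \<subseteq> pairs U \<and> card F = m (card U)})"
  let ?N = "\<lambda>F. {E \<in> ?G. F \<subseteq> E}"
  have finG: "finite ?G" using V by (rule finite_block_graphs)
  have c1: "c \<ge> 1"
  proof -
    have "real d1 ^ 2 \<ge> 1" using d by (intro one_le_power) auto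
    then show ?thesis by (simp add: c_def)
  qed
  have L1: "L \<ge> 1" unfolding L_def using c1
    by (metis (no_types, opaque_lifting) mult_ge1_I one_le_numeral one_le_power)
  have eta: "\<eta> = 1 / (256 * L)" by (simp add: \<eta>_def sparsity_radius_def L_def c_def)
  have n0: "n > 0" using n d by (cases n) auto
  have cV: "card V = 2 * n" using A V by (metis card_Diff_subset card_mono finite_subset le_add_diff_inverse mult_2)
  \<comment> \<open>The first bound is the smallness condition for the union bound; the second keeps
    the prescribed edge set below \<open>n / 2\<close>, as the switching estimate requires.\<close>
  have uM: "L * real u / real n \<le> 1 / 256" "2 * m u \<le> n" if u: "u \<in> {1..M}" for u
  proof -
    have "real u \<le> \<eta> * real n" using u L1 unfolding M_def
      by (metis atLeastAtMost_iff eta le_nat_floor nat_floor_neg not_one_le_zero of_nat_floor order.trans of_nat_mono linorder_le_cases)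
    then show *: "L * real u / real n \<le> 1 / 256" using n0 L1 by (simp add: eta field_simps)
    have "real u * 1 \<le> real u * L" using L1 by (intro mult_left_mono) auto
    then have "256 * real u \<le> real n" using * n0 by (simp add: field_simps)
    then have "256 * u \<le> n" by linarith
    moreover have "m u \<le> 3 * u" 
    proof -
      have "w + v + 1 \<le> 3 * w" if "v \<le> w" "1 \<le> w" for v w :: nat using that by linarith
      from this[OF div_le_dividend] show ?thesis using u unfolding m_def atLeastAtMost_iff by blast
    qed
    ultimately show "2 * m u \<le> n" by linarith
  qed
  have sub: "{E \<in> ?G. \<exists>U\<subseteq>V. U \<noteq> {} \<and> real (card U) \<le> \<eta> * real n \<and> 5 * card U < 4 * card {e \<in> E. e \<subseteq> U}}
     \<subseteq> (\<Union>u\<in>{1..M}. \<Union>U\<in>\<U> u. \<Union>F\<in>\<F> U. ?N F)"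
  proof
    fix E assume "E \<in> {E \<in> ?G. \<exists>U\<subseteq>V. U \<noteq> {} \<and> real (card U) \<le> \<eta> * real n \<and> 5 * card U < 4 * card {e \<in> E. e \<subseteq> U}}"
    then obtain U where E: "E \<in> ?G" and U: "U \<subseteq> V" "U \<noteq> {}" "real (card U) \<le> \<eta> * real n"
      and dense: "5 * card U < 4 * card {e \<in> E. e \<subseteq> U}" by blast
    have "card U \<noteq> 0" using finite_subset[OF U(1) V] U(2) by simp
    moreover have "card U \<le> M" using U(3) by (simp add: M_def le_nat_floor)
    ultimately have uM: "card U \<in> {1..M}" by simp
    have "m (card U) \<le> card {e \<in> E. e \<subseteq> U}" 
    proof -
      have "card U < (card {e \<in> E. e \<subseteq> U} - card U) * 4" using dense by linarith
      then have "card U div 4 < card {e \<in> E. e \<subseteq> U} - card U" by (simp add: div_less_iff_less_mult)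
      moreover have "w + v + 1 \<le> k" if "v < k - w" for v w k :: nat using that by linarith
      ultimately show ?thesis unfolding m_def by blast
    qed
    then obtain F where F: "F \<subseteq> {e \<in> E. e \<subseteq> U}" "card F = m (card U)"
      by (meson obtain_subset_with_card_n)
    have "F \<subseteq> pairs U" using F E by (auto simp: block_graphs_def pairs_def)
    then show "E \<in> (\<Union>u\<in>{1..M}. \<Union>U\<in>\<U> u. \<Union>F\<in>\<F> U. ?N F)"
      using uM U(1) F E by (intro UN_I[of "card U"] UN_I[of U] UN_I[of F]) (auto simp: \<U>_def \<F>_def)
  qed
  have finU: "finite (\<U> u)" for u unfolding \<U>_def using V by simp
  have finF: "finite (\<F> U)" if "U \<in> \<U> u" for u U
  proof (rule finite_subset)
    show "finite (Pow (pairs U))" using that V finite_subset finite_pairs by (auto simp: \<U>_def)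
  qed (auto simp: \<F>_def)
  have NF: "real (card (?N F)) \<le> (c / real n) ^ m u * real (card ?G)"
    if u: "u \<in> {1..M}" and U: "U \<in> \<U> u" and F: "F \<in> \<F> U" for u U F
  proof -
    have "card F = m u" "F \<subseteq> pairs V" using U F by (auto simp: \<U>_def \<F>_def pairs_def)
    then have "card (?N F) * n ^ m u \<le> (4 * d1\<^sup>2) ^ m u * card ?G"
      using card_containing_le[OF V A d n, of F] uM(2)[OF u] by simp
    then have "real (card (?N F) * n ^ m u) \<le> real ((4 * d1\<^sup>2) ^ m u * card ?G)" by (rule of_nat_mono)
    then have "real (card (?N F)) * real n ^ m u \<le> c ^ m u * real (card ?G)" by (simp add: c_def)
    then show ?thesis using n0 by (simp add: power_divide field_simps)
  qed
  have "real (card {E \<in> ?G. \<exists>U\<subseteq>V. U \<noteq> {} \<and> real (card U) \<le> \<eta> * real n \<and> 5 * card U < 4 * card {e \<in> E. e \<subseteq> U}})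
     \<le> real (card (\<Union>u\<in>{1..M}. \<Union>U\<in>\<U> u. \<Union>F\<in>\<F> U. ?N F))"
    by (intro of_nat_mono card_mono sub) (use finU finF finG in auto)
  also have "\<dots> \<le> (\<Sum>u\<in>{1..M}. real (card (\<Union>U\<in>\<U> u. \<Union>F\<in>\<F> U. ?N F)))"
    by (rule real_card_UN_le) simp
  also have "\<dots> \<le> (\<Sum>u\<in>{1..M}. L * 64 / real n / 2 ^ u * real (card ?G))"
  proof (rule sum_mono)
    fix u assume u: "u \<in> {1..M}"
    have "real (card (\<Union>U\<in>\<U> u. \<Union>F\<in>\<F> U. ?N F)) \<le> (\<Sum>U\<in>\<U> u. real (card (\<Union>F\<in>\<F> U. ?N F)))"
      by (rule real_card_UN_le[OF finU])
    also have "\<dots> \<le> (\<Sum>U\<in>\<U> u. real ((u choose 2) choose m u) * ((c / real n) ^ m u * real (card ?G)))"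
    proof (rule sum_mono)
      fix U assume U: "U \<in> \<U> u"
      have "real (card (\<Union>F\<in>\<F> U. ?N F)) \<le> (\<Sum>F\<in>\<F> U. real (card (?N F)))"
        by (rule real_card_UN_le[OF finF[OF U]])
      also have "\<dots> \<le> (\<Sum>F\<in>\<F> U. (c / real n) ^ m u * real (card ?G))"
        by (rule sum_mono) (use NF u U in blast)
      also have "\<dots> = real (card (\<F> U)) * ((c / real n) ^ m u * real (card ?G))" by simp
      also have "card (\<F> U) = (u choose 2) choose m u"
      proof -
        have "finite U" "card U = u" using U V finite_subset by (auto simp: \<U>_def)
        then show ?thesis unfolding \<F>_def by (simp add: n_subsets finite_pairs card_pairs)
      qed
      finally show "real (card (\<Union>F\<in>\<F> U. ?N F)) \<le> real ((u choose 2) choose m u) * ((c / real n) ^ m u * real (card ?G))" .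
    qed
    also have "\<dots> = real (card (\<U> u)) * real ((u choose 2) choose m u) * (c / real n) ^ m u * real (card ?G)"
      by simp
    also have "card (\<U> u) = 2 * n choose u" unfolding \<U>_def using V by (simp add: n_subsets cV)
    also have "real (2 * n choose u) * real ((u choose 2) choose m u) * (c / real n) ^ m u * real (card ?G)
        \<le> L * 64 / real n / 2 ^ u * real (card ?G)"
      unfolding L_def m_def
      by (intro mult_right_mono union_bound_term) (use c1 n0 u uM(1)[OF u] in \<open>auto simp: L_def\<close>)
    finally show "real (card (\<Union>U\<in>\<U> u. \<Union>F\<in>\<F> U. ?N F)) \<le> L * 64 / real n / 2 ^ u * real (card ?G)" .
  qed
  also have "\<dots> = L * 64 / real n * real (card ?G) * (\<Sum>u\<in>{1..M}. (1 / 2) ^ u)"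
    unfolding sum_distrib_left by (intro sum.cong refl) (simp add: power_one_over)
  also have "\<dots> \<le> L * 64 / real n * real (card ?G) * 1"
  proof (rule mult_left_mono)
    have "(\<Sum>u\<in>{1..N}. (1 / 2) ^ u) = 1 - (1 / 2 :: real) ^ N" for N
      by (induction N) auto
    then show "(\<Sum>u\<in>{1..M}. (1 / 2) ^ u) \<le> (1::real)" by simp
  qed (use L1 in simp)
  also have "L * 64 = 1 / (4 * \<eta>)" using L1 by (simp add: eta)
  finally show ?thesis by simp
qed

section \<open>Majority dynamics\<close>

text \<open>Ordered pairs from \<open>T\<close> to \<open>S\<close> number at least
  \<open>3 * card T\<close>. Reversing those that start in \<open>T - S\<close> gives
  \<open>3 * card (T - S)\<close> further ones, disjoint from the first since they end outside
  \<open>S\<close>. Every edge inside \<open>S \<union> T\<close> yields at most two ordered pairs,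
  so sparsity bounds the total.\<close>

lemma card_three_neighbours_le:
  assumes V: "finite V" and E: "E \<subseteq> pairs V" and S: "S \<subseteq> V" and T: "T \<subseteq> V"
    and three: "\<And>v. v \<in> T \<Longrightarrow> 3 \<le> card (neighbours E v \<inter> S)"
    and sparse: "4 * card {e \<in> E. e \<subseteq> S \<union> T} \<le> 5 * card (S \<union> T)"
  shows "6 * card T \<le> 5 * card S"
proof -
  let ?F = "{e \<in> E. e \<subseteq> S \<union> T}"
  have finE: "finite E" using E V finite_pairs finite_subset by blast
  have fS: "finite S" "finite T" using S T V finite_subset by auto
  have fN: "finite (neighbours E v \<inter> S)" for v using fS by simp
  define P where "P = (SIGMA v:T. neighbours E v \<inter> S)"
  define Q where "Q = prod.swap ` (SIGMA v:T - S. neighbours E v \<inter> S)"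
  have fin: "finite P" "finite Q" unfolding P_def Q_def using fS fN by auto
  have "card P = (\<Sum>v\<in>T. card (neighbours E v \<inter> S))"
    unfolding P_def by (rule card_SigmaI) (use fS in auto)
  also have "\<dots> \<ge> (\<Sum>v\<in>T. 3)" by (rule sum_mono) (use three in auto)
  finally have P: "card P \<ge> 3 * card T" by simp
  have "card Q = card (SIGMA v:T - S. neighbours E v \<inter> S)" unfolding Q_def by (simp add: card_image)
  also have "\<dots> = (\<Sum>v\<in>T - S. card (neighbours E v \<inter> S))"
    by (rule card_SigmaI) (use fS in auto)
  also have "\<dots> \<ge> (\<Sum>v\<in>T - S. 3)" by (rule sum_mono) (use three in auto)
  finally have Q: "card Q \<ge> 3 * card (T - S)" by simp
  have "P \<inter> Q = {}" unfolding P_def Q_def by auto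
  then have "card P + card Q = card (P \<union> Q)" using fin by (simp add: card_Un_disjoint)
  also have "\<dots> \<le> card {(v, w). {v, w} \<in> ?F}"
  proof (rule card_mono)
    show "finite {(v, w). {v, w} \<in> ?F}"
      by (rule card_ordered_pairs_le(1)[of _ V]) (use finE E in auto)
    show "P \<union> Q \<subseteq> {(v, w). {v, w} \<in> ?F}"
      unfolding P_def Q_def by (auto simp: neighbours_def insert_commute)
  qed
  also have "\<dots> \<le> 2 * card ?F"
    by (rule card_ordered_pairs_le(2)[of _ V]) (use finE E in auto)
  finally have "3 * card T + 3 * card (T - S) \<le> 2 * card ?F" using P Q by linarith
  moreover have "card (S \<union> T) = card S + card (T - S)"
    using fS by (metis Diff_disjoint Un_Diff_cancel card_Un_disjoint finite_Diff)
  moreover have "card (T - S) \<le> card T" using fS by (simp add: card_mono)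
  ultimately show ?thesis using sparse by linarith
qed

lemma majority_error_contraction:
  assumes V: "finite V" and E: "E \<subseteq> pairs V" and S: "S \<subseteq> V" and T: "T \<subseteq> V"
    and three: "\<And>v. v \<in> T \<Longrightarrow> 3 \<le> card (neighbours E v \<inter> S)"
    and sparse: "\<And>U. U \<subseteq> V \<Longrightarrow> card U \<le> 2 * card S \<Longrightarrow> 4 * card {e \<in> E. e \<subseteq> U} \<le> 5 * card U"
  shows "6 * card T \<le> 5 * card S"
proof -
  have small: "6 * card T' \<le> 5 * card S" if "T' \<subseteq> T" "card T' \<le> card S" for T'
  proof (rule card_three_neighbours_le[OF V E S])
    show "4 * card {e \<in> E. e \<subseteq> S \<union> T'} \<le> 5 * card (S \<union> T')"
      by (rule sparse) (use that S T card_Un_le[of S T'] in auto)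
  qed (use that T three in auto)
  show ?thesis
  proof (cases "card T \<le> card S")
    case True
    then show ?thesis using small by blast
  next
    case False
    \<comment> \<open>Sparsity is only available for small sets, so \<open>T\<close> is trimmed to the size of \<open>S\<close>.\<close>
    then obtain T' where T': "T' \<subseteq> T" "card T' = card S"
      by (meson nat_le_linear obtain_subset_with_card_n)
    \<comment> \<open>The bound would read \<open>6 * card S \<le> 5 * card S\<close>. With
      \<open>S\<close> empty, no vertex has three neighbours in it, so \<open>T\<close> is empty
      too.\<close>
    then have "card S = 0" using small[of T'] by simp
    then have "S = {}" using finite_subset[OF S V] by simp
    then have "T = {}" using three by fastforce
    then show ?thesis by simp
  qed
qed

section \<open>One majority step and its iterates\<close>

lemma sum_spin:
  assumes "finite N"
  shows "(\<Sum>j\<in>N. spin A j) = int (card {j \<in> N. j \<in> A}) - int (card {j \<in> N. j \<notin> A})"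
proof -
  have "N = {j \<in> N. j \<in> A} \<union> {j \<in> N. j \<notin> A}" by auto
  then have "(\<Sum>j\<in>N. spin A j) = (\<Sum>j\<in>{j \<in> N. j \<in> A}. spin A j) + (\<Sum>j\<in>{j \<in> N. j \<notin> A}. spin A j)"
    using assms by (subst sum.union_disjoint[symmetric]) auto
  then show ?thesis by (simp add: spin_def)
qed

text \<open>Under the true labels the sum at \<open>v\<close> favours its own side by
  \<open>d1 - d2 \<ge> 5\<close>, and each mislabelled neighbour shifts it by 2. Two of them leave
  the sign correct, so an error takes at least three.\<close>

lemma majority_error_three_neighbours:
  assumes V: "finite V" and E: "E \<in> block_graphs V \<A> d1 d2" and d: "d1 > d2 + 4"
    and v: "v \<in> V" and \<A>: "\<A> \<subseteq> V" and A: "A \<subseteq> V"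
    and err: "(v \<in> majority_step V E tie A) \<noteq> (v \<in> \<A>)"
  shows "3 \<le> card (neighbours E v \<inter> (sym_diff A \<A>))"
proof -
  let ?N = "neighbours E v"
  have EV: "E \<subseteq> pairs V" using E by (simp add: block_graphs_def)
  have fN: "finite ?N" using EV V finite_neighbours by blast
  have deg: "card {w \<in> ?N. (w \<in> \<A>) = (v \<in> \<A>)} = d1" "card {w \<in> ?N. (w \<in> \<A>) \<noteq> (v \<in> \<A>)} = d2"
    using E v by (auto simp: block_graphs_def)
  let ?D = "?N \<inter> (sym_diff A \<A>)"
  have a: "{w \<in> ?N. w \<in> \<A>} \<subseteq> {w \<in> ?N. w \<in> A} \<union> ?D" "{w \<in> ?N. w \<notin> \<A>} \<subseteq> {w \<in> ?N. w \<notin> A} \<union> ?D"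
    "{w \<in> ?N. w \<in> A} \<subseteq> {w \<in> ?N. w \<in> \<A>} \<union> ?D" "{w \<in> ?N. w \<notin> A} \<subseteq> {w \<in> ?N. w \<notin> \<A>} \<union> ?D"
    by auto
  have le: "card X \<le> card Y + card ?D" if "X \<subseteq> Y \<union> ?D" "finite Y" for X Y
    using card_mono[OF _ that(1)] that(2) fN card_Un_le[of Y ?D] by simp
  have c: "card {w \<in> ?N. w \<in> \<A>} \<le> card {w \<in> ?N. w \<in> A} + card ?D"
    "card {w \<in> ?N. w \<notin> \<A>} \<le> card {w \<in> ?N. w \<notin> A} + card ?D"
    "card {w \<in> ?N. w \<in> A} \<le> card {w \<in> ?N. w \<in> \<A>} + card ?D"
    "card {w \<in> ?N. w \<notin> A} \<le> card {w \<in> ?N. w \<notin> \<A>} + card ?D"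
    by (rule le[OF a(1)] le[OF a(2)] le[OF a(3)] le[OF a(4)]; use fN in simp)+
  note sp = sum_spin[OF fN, of A]
  show ?thesis
  proof (cases "v \<in> \<A>")
    case True
    \<comment> \<open>Equality is possible because \<open>tie\<close> may resolve a zero sum against
      \<open>v\<close>.\<close>
    then have "(\<Sum>j\<in>?N. spin A j) \<le> 0" using err v by (auto simp: majority_step_def)
    moreover have "card {w \<in> ?N. w \<in> \<A>} = d1" "card {w \<in> ?N. w \<notin> \<A>} = d2" using deg True by simp_all
    ultimately show ?thesis using c sp d by linarith
  next
    case False
    then have "(\<Sum>j\<in>?N. spin A j) \<ge> 0" using err v by (auto simp: majority_step_def)
    moreover have "card {w \<in> ?N. w \<in> \<A>} = d2" "card {w \<in> ?N. w \<notin> \<A>} = d1" using deg False by simp_all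
    ultimately show ?thesis using c sp d by linarith
  qed
qed

text \<open>The error never grows, so sparsity relative to the initial error set suffices at every
  iteration, and the factor \<open>5 / 6\<close> accumulates.\<close>

lemma majority_iterate_error:
  assumes V: "finite V" and E: "E \<in> block_graphs V \<A> d1 d2" and d: "d1 > d2 + 4"
    and \<A>: "\<A> \<subseteq> V" and A: "A \<subseteq> V"
    and sparse: "\<And>U. U \<subseteq> V \<Longrightarrow> card U \<le> 2 * card (sym_diff A \<A>) \<Longrightarrow> 4 * card {e \<in> E. e \<subseteq> U} \<le> 5 * card U"
  shows "(majority_step V E tie ^^ t) A \<subseteq> V \<and>
    real (card (sym_diff ((majority_step V E tie ^^ t) A) \<A>)) \<le> (5 / 6) ^ t * real (card (sym_diff A \<A>))"
proof (induction t)
  case 0 then show ?case using A by simp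
next
  case (Suc t)
  let ?B = "(majority_step V E tie ^^ t) A"
  let ?C = "majority_step V E tie ?B"
  let ?S = "sym_diff ?B \<A>" and ?T = "sym_diff ?C \<A>"
  have EV: "E \<subseteq> pairs V" using E by (simp add: block_graphs_def)
  have B: "?B \<subseteq> V" using Suc by blast
  have C: "?C \<subseteq> V" by (auto simp: majority_step_def)
  have "real (card ?S) \<le> (5 / 6) ^ t * real (card (sym_diff A \<A>))" using Suc by simp
  also have "\<dots> \<le> 1 * real (card (sym_diff A \<A>))" by (intro mult_right_mono power_le_one) auto
  finally have mono: "card ?S \<le> card (sym_diff A \<A>)" by simp
  have "6 * card ?T \<le> 5 * card ?S"
  proof (rule majority_error_contraction[OF V EV])
    show "?S \<subseteq> V" "?T \<subseteq> V" using B C \<A> by auto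
    show "3 \<le> card (neighbours E v \<inter> ?S)" if "v \<in> ?T" for v
      by (rule majority_error_three_neighbours[OF V E d _ \<A> B]) (use that C \<A> in auto)
    show "4 * card {e \<in> E. e \<subseteq> U} \<le> 5 * card U" if "U \<subseteq> V" "card U \<le> 2 * card ?S" for U
      by (rule sparse) (use that mono in auto)
  qed
  then have "6 * real (card ?T) \<le> 5 * real (card ?S)" by linarith
  then have "real (card ?T) \<le> 5 / 6 * real (card ?S)" by simp
  also have "\<dots> \<le> 5 / 6 * ((5 / 6) ^ t * real (card (sym_diff A \<A>)))" using Suc by (intro mult_left_mono) auto
  finally show ?case using C by simp
qed

lemma majority_converges:
  assumes V: "finite V" and E: "E \<in> block_graphs V \<A> d1 d2" and d: "d1 > d2 + 4"
    and \<A>: "\<A> \<subseteq> V" and A: "A \<subseteq> V" and n: "3 \<le> n" "real (card (sym_diff A \<A>)) \<le> real n"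
    and sparse: "\<And>U. U \<subseteq> V \<Longrightarrow> card U \<le> 2 * card (sym_diff A \<A>) \<Longrightarrow> 4 * card {e \<in> E. e \<subseteq> U} \<le> 5 * card U"
  shows "\<exists>t. real t \<le> (1 / ln (6 / 5) + 1) * ln (real n) \<and> (majority_step V E tie ^^ t) A = \<A>"
proof -
  \<comment> \<open>The extra step makes \<open>(6 / 5) ^ t\<close> strictly exceed
    \<open>n\<close>, so the final error count is an integer below 1.\<close>
  define t where "t = nat \<lfloor>ln (real n) / ln (6 / 5)\<rfloor> + 1"
  \<comment> \<open>This absorbs the additive 1 in \<open>t\<close> into a multiple of
    \<open>ln n\<close>.\<close>
  have ln3: "ln (real n) \<ge> 1"
  proof -
    have "exp 1 \<le> real n" using exp_le n(1) by linarith
    then show ?thesis using n(1) by (subst ln_ge_iff) auto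
  qed
  have l65: "ln (6 / 5 :: real) > 0" by simp
  have t: "real t > ln (real n) / ln (6 / 5)" unfolding t_def by linarith
  have "real t \<le> ln (real n) / ln (6 / 5) + 1" using ln3 l65 unfolding t_def by simp
  also have "\<dots> \<le> (1 / ln (6 / 5) + 1) * ln (real n)" using ln3 by (simp add: algebra_simps)
  finally have tle: "real t \<le> (1 / ln (6 / 5) + 1) * ln (real n)" .
  let ?B = "(majority_step V E tie ^^ t) A"
  have "ln (real n) < real t * ln (6 / 5)" using t l65 by (simp add: field_simps)
  then have "real n < (6 / 5) ^ t"
    using n(1) by (metis exp_less_mono exp_ln exp_of_nat_mult divide_pos_pos of_nat_0_less_iff less_le_trans zero_less_numeral)
  have "real (card (sym_diff ?B \<A>)) \<le> (5 / 6) ^ t * real (card (sym_diff A \<A>))"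
    using majority_iterate_error[OF V E d \<A> A sparse] by blast
  also have "\<dots> \<le> (5 / 6) ^ t * real n" using n(2) by (intro mult_left_mono) auto
  also have "\<dots> < (5 / 6) ^ t * (6 / 5) ^ t" using \<open>real n < (6 / 5) ^ t\<close> by (intro mult_strict_left_mono) auto
  also have "\<dots> = 1" by (simp flip: power_mult_distrib)
  finally have "card (sym_diff ?B \<A>) = 0" by simp
  moreover have "?B \<subseteq> V" using majority_iterate_error[OF V E d \<A> A sparse] by blast
  then have "finite (sym_diff ?B \<A>)" using V \<A> by (auto dest: finite_subset)
  ultimately have "?B = \<A>" by auto
  then show ?thesis using tle by blast
qed

section \<open>Regular graphs and the block model\<close>

text \<open>Sending a neighbour \<open>w\<close> to the edge \<open>{v, w}\<close> is a bijection
  onto the edges at \<open>v\<close>. It links the edge-counting degrees of the model to the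
  neighbour counts used for switchings.\<close>

lemma degree_eq_card_neighbours:
  assumes "E \<subseteq> pairs V"
  shows "degree E v = card (neighbours E v)"
proof -
  have "bij_betw (\<lambda>w. {v, w}) (neighbours E v) {e \<in> E. v \<in> e}"
  proof (rule bij_betw_imageI)
    show "inj_on (\<lambda>w. {v, w}) (neighbours E v)" by (rule inj_onI) (auto simp: doubleton_eq_iff)
    show "(\<lambda>w. {v, w}) ` neighbours E v = {e \<in> E. v \<in> e}"
    proof (intro set_eqI iffI)
      fix e assume e: "e \<in> {e \<in> E. v \<in> e}"
      then have "card e = 2" using assms by (auto simp: pairs_def)
      then obtain a b where "e = {a, b}" by (auto simp: card_2_iff)
      then obtain w where "e = {v, w}" using e by auto
      then show "e \<in> (\<lambda>w. {v, w}) ` neighbours E v" using e by (auto simp: neighbours_def)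
    qed (auto simp: neighbours_def)
  qed
  then show ?thesis unfolding degree_def by (metis bij_betw_same_card)
qed

definition cross_pairs :: "'a set \<Rightarrow> 'a set \<Rightarrow> 'a set set" where
  "cross_pairs S T = {{a, b} | a b. a \<in> S \<and> b \<in> T}"

lemma cross_pairs_subset: "S \<inter> T = {} \<Longrightarrow> cross_pairs S T \<subseteq> pairs (S \<union> T)"
  by (auto simp: cross_pairs_def)

lemma doubleton_in_cross_pairs [simp]:
  "{a, b} \<in> cross_pairs S T \<longleftrightarrow> a \<in> S \<and> b \<in> T \<or> b \<in> S \<and> a \<in> T"
  by (auto simp: cross_pairs_def doubleton_eq_iff)

lemma reg_graphs_iff:
  "E \<in> reg_graphs S d \<longleftrightarrow> E \<subseteq> pairs S \<and> (\<forall>v\<in>S. card (neighbours E v) = d)"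
  using degree_eq_card_neighbours[of E S] by (auto simp: reg_graphs_def pairs_def)

lemma bip_reg_graphs_iff:
  assumes "S \<inter> T = {}"
  shows "E \<in> bip_reg_graphs S T d \<longleftrightarrow> E \<subseteq> cross_pairs S T \<and> (\<forall>v\<in>S \<union> T. card (neighbours E v) = d)"
proof (cases "E \<subseteq> cross_pairs S T")
  case True
  then have "E \<subseteq> pairs (S \<union> T)" using cross_pairs_subset[OF assms] by blast
  then show ?thesis using degree_eq_card_neighbours[of E "S \<union> T"] by (auto simp: bip_reg_graphs_def cross_pairs_def)
next
  case False
  then show ?thesis by (auto simp: bip_reg_graphs_def cross_pairs_def)
qed

lemma block_graphs_iff:
  assumes E: "E \<subseteq> pairs V" and A: "A \<subseteq> V"
  shows "E \<in> block_graphs V A d1 d2 \<longleftrightarrow>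
    E \<inter> pairs A \<in> reg_graphs A d1 \<and> E \<inter> pairs (V - A) \<in> reg_graphs (V - A) d1 \<and>
    E \<inter> cross_pairs A (V - A) \<in> bip_reg_graphs A (V - A) d2"
proof -
  have nb: "w \<in> V \<and> w \<noteq> v" if "w \<in> neighbours E v" for v w
    using neighbours_subset[OF E] that by blast
  define same where "same v = {w \<in> neighbours E v. (w \<in> A) = (v \<in> A)}" for v
  define other where "other v = {w \<in> neighbours E v. (w \<in> A) \<noteq> (v \<in> A)}" for v
  have in_in: "same v = neighbours (E \<inter> pairs A) v" if "v \<in> A" for v
    using that nb by (auto simp: neighbours_def same_def other_def)
  have in_out: "other v = neighbours (E \<inter> cross_pairs A (V - A)) v" if "v \<in> A" for v
    using that nb by (auto simp: neighbours_def same_def other_def)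
  have out_out: "same v = neighbours (E \<inter> pairs (V - A)) v" if "v \<in> V - A" for v
    using that nb by (auto simp: neighbours_def same_def other_def)
  have out_in: "other v = neighbours (E \<inter> cross_pairs A (V - A)) v" if "v \<in> V - A" for v
    using that nb by (auto simp: neighbours_def same_def other_def)
  have split: "(\<forall>v\<in>V. P v) \<longleftrightarrow> (\<forall>v\<in>A. P v) \<and> (\<forall>v\<in>V - A. P v)" for P
    using A by blast
  have "E \<in> block_graphs V A d1 d2 \<longleftrightarrow> (\<forall>v\<in>V. card (same v) = d1 \<and> card (other v) = d2)"
    using E by (simp add: block_graphs_def same_def other_def)
  also have "\<dots> \<longleftrightarrow>
    (\<forall>v\<in>A. card (neighbours (E \<inter> pairs A) v) = d1 \<and> card (neighbours (E \<inter> cross_pairs A (V - A)) v) = d2) \<and>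
    (\<forall>v\<in>V - A. card (neighbours (E \<inter> pairs (V - A)) v) = d1 \<and> card (neighbours (E \<inter> cross_pairs A (V - A)) v) = d2)"
    unfolding split by (simp only: in_in in_out out_out out_in cong: ball_cong)
  also have "\<dots> \<longleftrightarrow> E \<inter> pairs A \<in> reg_graphs A d1 \<and> E \<inter> pairs (V - A) \<in> reg_graphs (V - A) d1 \<and>
    E \<inter> cross_pairs A (V - A) \<in> bip_reg_graphs A (V - A) d2"
    using A by (subst bip_reg_graphs_iff) (auto simp: reg_graphs_iff)
  finally show ?thesis .
qed

text \<open>The pairs inside \<open>A\<close>, the pairs inside \<open>V - A\<close> and the
  crossing pairs partition all pairs of \<open>V\<close>, so intersecting with the three families
  inverts the union.\<close>

lemma bij_betw_block_graphs:
  assumes A: "A \<subseteq> V"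
  shows "bij_betw (\<lambda>(E1, E2, E3). E1 \<union> E2 \<union> E3)
    (reg_graphs A d1 \<times> reg_graphs (V - A) d1 \<times> bip_reg_graphs A (V - A) d2) (block_graphs V A d1 d2)"
proof (rule bij_betw_byWitness[where f' = "\<lambda>E. (E \<inter> pairs A, E \<inter> pairs (V - A), E \<inter> cross_pairs A (V - A))"])
  let ?R = "reg_graphs A d1 \<times> reg_graphs (V - A) d1 \<times> bip_reg_graphs A (V - A) d2"
  let ?r = "\<lambda>E. (E \<inter> pairs A, E \<inter> pairs (V - A), E \<inter> cross_pairs A (V - A))"
  have disj: "pairs A \<inter> pairs (V - A) = {}" "pairs A \<inter> cross_pairs A (V - A) = {}" "pairs (V - A) \<inter> cross_pairs A (V - A) = {}"
    by (auto simp: pairs_def cross_pairs_def card_2_iff)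
  have sub: "pairs A \<subseteq> pairs V" "pairs (V - A) \<subseteq> pairs V" "cross_pairs A (V - A) \<subseteq> pairs V"
    using A cross_pairs_subset[of A "V - A"] by (auto simp: pairs_def Un_absorb1)
  have cover: "e \<in> pairs A \<or> e \<in> pairs (V - A) \<or> e \<in> cross_pairs A (V - A)" if "e \<in> pairs V" for e
  proof -
    have "card e = 2" using that by (simp add: pairs_def)
    then obtain a b where "e = {a, b}" by (auto simp: card_2_iff)
    then show ?thesis using that by auto
  qed
  have parts: "E1 \<subseteq> pairs A \<and> E2 \<subseteq> pairs (V - A) \<and> E3 \<subseteq> cross_pairs A (V - A)" if "(E1, E2, E3) \<in> ?R" for E1 E2 E3
    using that by (auto simp: reg_graphs_iff bip_reg_graphs_iff)
  have r: "?r (E1 \<union> E2 \<union> E3) = (E1, E2, E3)" if "(E1, E2, E3) \<in> ?R" for E1 E2 E3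
    using parts[OF that] disj by blast
  show "\<forall>x\<in>?R. ?r (case x of (E1, E2, E3) \<Rightarrow> E1 \<union> E2 \<union> E3) = x"
    using r by auto
  show "\<forall>E\<in>block_graphs V A d1 d2. (case ?r E of (E1, E2, E3) \<Rightarrow> E1 \<union> E2 \<union> E3) = E"
    using cover by (auto simp: block_graphs_def)
  show "(\<lambda>(E1, E2, E3). E1 \<union> E2 \<union> E3) ` ?R \<subseteq> block_graphs V A d1 d2"
  proof (rule image_subsetI)
    fix x assume "x \<in> ?R"
    then obtain E1 E2 E3 where x: "x = (E1, E2, E3)" and xR: "(E1, E2, E3) \<in> ?R" by (cases x) auto
    have "E1 \<union> E2 \<union> E3 \<subseteq> pairs V" using parts[OF xR] sub by blast
    then have "E1 \<union> E2 \<union> E3 \<in> block_graphs V A d1 d2"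
      using r[OF xR] xR by (subst block_graphs_iff[OF _ A]) auto
    then show "(case x of (E1, E2, E3) \<Rightarrow> E1 \<union> E2 \<union> E3) \<in> block_graphs V A d1 d2" using x by simp
  qed
  show "?r ` block_graphs V A d1 d2 \<subseteq> ?R"
  proof (rule image_subsetI)
    fix E assume E: "E \<in> block_graphs V A d1 d2"
    then have "E \<subseteq> pairs V" by (simp add: block_graphs_def)
    then show "?r E \<in> ?R" using block_graphs_iff[OF _ A] E by auto
  qed
qed

section \<open>Circulant constructions of regular graphs\<close>

definition cyclic_diff :: "nat \<Rightarrow> nat \<Rightarrow> nat \<Rightarrow> nat" where
  "cyclic_diff n i j = (if i \<le> j then j - i else j + n - i)"

lemma card_vimage_inj_endo:
  assumes "inj_on g {0..<n}" "g ` {0..<n} \<subseteq> {0..<n}" "D \<subseteq> {0..<(n::nat)}"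
  shows "card {j \<in> {0..<n}. g j \<in> D} = card D"
proof -
  have "g ` {0..<n} = {0..<n}" using assms by (intro endo_inj_surj) auto
  moreover have "g ` {j \<in> {0..<n}. g j \<in> D} = g ` {0..<n} \<inter> D" by auto
  ultimately have "g ` {j \<in> {0..<n}. g j \<in> D} = D" using assms(3) by auto
  moreover have "inj_on g {j \<in> {0..<n}. g j \<in> D}" using assms(1) by (rule inj_on_subset) auto
  ultimately show ?thesis by (metis card_image)
qed

text \<open>\<open>cyclic_diff n i j\<close> is the residue of \<open>j - i\<close> modulo
  \<open>n\<close>. With one argument fixed it permutes the residues in the other, so preimages keep
  their size.\<close>

lemma card_cyclic_diff:
  assumes "i < n" "D \<subseteq> {0..<n}"
  shows "card {j \<in> {0..<n}. cyclic_diff n i j \<in> D} = card D"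
    and "card {j \<in> {0..<n}. cyclic_diff n j i \<in> D} = card D"
  using assms by (intro card_vimage_inj_endo; auto simp: inj_on_def cyclic_diff_def split: if_splits)+

text \<open>A bipartite circulant graph: with both sides indexed by residues modulo
  \<open>n\<close>, \<open>f i\<close> is joined to \<open>g j\<close> when \<open>j - i\<close> is
  one of \<open>d\<close> consecutive residues.\<close>

lemma bip_reg_graphs_nonempty:
  assumes fin: "finite S" "finite T" and card: "card S = n" "card T = n" and disj: "S \<inter> T = {}" and d: "d \<le> n"
  shows "bip_reg_graphs S T d \<noteq> {}"
proof -
  obtain f where f: "bij_betw f {0..<n} S" using ex_bij_betw_nat_finite[OF fin(1)] card by auto
  obtain g where g: "bij_betw g {0..<n} T" using ex_bij_betw_nat_finite[OF fin(2)] card by auto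
  define E where "E = {{f i, g j} | i j. i < n \<and> j < n \<and> cyclic_diff n i j \<in> {0..<d}}"
  have fS: "f i \<in> S" and gT: "g i \<in> T" if "i < n" for i
    using that bij_betwE[OF f] bij_betwE[OF g] by auto
  have finj: "f i = f j \<longleftrightarrow> i = j" and ginj: "g i = g j \<longleftrightarrow> i = j" if "i < n" "j < n" for i j
    using that inj_on_eq_iff[OF bij_betw_imp_inj_on[OF f]] inj_on_eq_iff[OF bij_betw_imp_inj_on[OF g]] by auto
  have ne: "f i \<noteq> g j" if "i < n" "j < n" for i j
    using fS[OF that(1)] gT[OF that(2)] disj by auto
  have sub: "E \<subseteq> cross_pairs S T" using fS gT by (auto simp: E_def)
  have mem: "{f i, g j} \<in> E \<longleftrightarrow> cyclic_diff n i j \<in> {0..<d}" if "i < n" "j < n" for i j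
    using that finj ginj ne by (auto simp: E_def doubleton_eq_iff)
  have nf: "neighbours E (f i) = g ` {j \<in> {0..<n}. cyclic_diff n i j \<in> {0..<d}}" if i: "i < n" for i
  proof (intro set_eqI iffI)
    fix w assume w: "w \<in> neighbours E (f i)"
    then have "{f i, w} \<in> cross_pairs S T" using sub by (auto simp: neighbours_def)
    then have "w \<in> T" using fS[OF i] disj by auto
    then obtain j where "j < n" "w = g j" using bij_betw_imp_surj_on[OF g] by auto
    then show "w \<in> g ` {j \<in> {0..<n}. cyclic_diff n i j \<in> {0..<d}}"
      using w mem[OF i] by (auto simp: neighbours_def)
  qed (use mem[OF i] in \<open>auto simp: neighbours_def\<close>)
  have ng: "neighbours E (g j) = f ` {i \<in> {0..<n}. cyclic_diff n i j \<in> {0..<d}}" if j: "j < n" for j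
  proof (intro set_eqI iffI)
    fix w assume w: "w \<in> neighbours E (g j)"
    then have "{g j, w} \<in> cross_pairs S T" using sub by (auto simp: neighbours_def)
    then have "w \<in> S" using gT[OF j] disj by auto
    then obtain i where "i < n" "w = f i" using bij_betw_imp_surj_on[OF f] by auto
    then show "w \<in> f ` {i \<in> {0..<n}. cyclic_diff n i j \<in> {0..<d}}"
      using w mem[OF _ j] by (auto simp: neighbours_def insert_commute)
  qed (use mem[OF _ j] in \<open>auto simp: neighbours_def insert_commute\<close>)
  have "card (neighbours E v) = d" if v: "v \<in> S \<union> T" for v
  proof -
    from v consider i where "i < n" "v = f i" | i where "i < n" "v = g i"
      using bij_betw_imp_surj_on[OF f] bij_betw_imp_surj_on[OF g] by fastforce
    then show ?thesis
    proof cases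
      case 1
      have "inj_on g {j \<in> {0..<n}. cyclic_diff n i j \<in> {0..<d}}"
        using bij_betw_imp_inj_on[OF g] by (rule inj_on_subset) auto
      then show ?thesis using 1 card_cyclic_diff(1)[of i n "{0..<d}"] d by (simp add: nf card_image)
    next
      case 2
      have "inj_on f {j \<in> {0..<n}. cyclic_diff n j i \<in> {0..<d}}"
        using bij_betw_imp_inj_on[OF f] by (rule inj_on_subset) auto
      then show ?thesis using 2 card_cyclic_diff(2)[of i n "{0..<d}"] d by (simp add: ng card_image)
    qed
  qed
  then have "E \<in> bip_reg_graphs S T d" using sub disj by (simp add: bip_reg_graphs_iff)
  then show ?thesis by blast
qed

text \<open>A circulant graph whose distance set is an interval of \<open>d\<close> residues centred
  at \<open>n / 2\<close>.\<close>

lemma reg_graphs_nonempty_odd: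
  assumes fin: "finite S" and card: "card S = n" and n: "odd n" and d: "even d" "d < n"
  shows "reg_graphs S d \<noteq> {}"
proof -
  obtain h where h: "bij_betw h {0..<n} S" using ex_bij_betw_nat_finite[OF fin] card by auto
  \<comment> \<open>The ends \<open>k\<close> and \<open>k + d - 1\<close> of the interval add up to
    \<open>n\<close>; the parities of \<open>n\<close> and \<open>d\<close> make this solvable. As
    \<open>d < n\<close>, also \<open>k \<ge> 1\<close>, which rules out distance 0 and hence
    loops.\<close>
  obtain k where k: "2 * k + d = n + 1"
  proof -
    have "even (n + 1 - d)" "d \<le> n + 1" using n d by auto
    then show ?thesis using that by (metis add.commute evenE le_add_diff_inverse)
  qed
  \<comment> \<open>This interval of distances is invariant under reversal, \<open>\<delta> \<mapsto> n - \<delta>\<close>.\<close>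
  define D where "D = {k..<k + d}"
  have D: "D \<subseteq> {0..<n}" "card D = d" using k d by (auto simp: D_def)
  define E where "E = {{h i, h j} | i j. i < n \<and> j < n \<and> cyclic_diff n i j \<in> D}"
  have hS: "h i \<in> S" if "i < n" for i using that bij_betwE[OF h] by auto
  have hinj: "h i = h j \<longleftrightarrow> i = j" if "i < n" "j < n" for i j
    using that inj_on_eq_iff[OF bij_betw_imp_inj_on[OF h]] by auto
  have rev: "cyclic_diff n j i \<in> D" if "i < n" "j < n" "cyclic_diff n i j \<in> D" for i j
    using that k d by (auto simp: cyclic_diff_def D_def split: if_splits)
  have irr: "cyclic_diff n i i \<notin> D" for i using k d by (auto simp: cyclic_diff_def D_def)
  have sub: "E \<subseteq> pairs S" using hS hinj irr by (auto simp: E_def)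
  have mem: "{h i, h j} \<in> E \<longleftrightarrow> cyclic_diff n i j \<in> D" if "i < n" "j < n" for i j
  proof
    assume "{h i, h j} \<in> E"
    then obtain a b where ab: "{h i, h j} = {h a, h b}" "a < n" "b < n" "cyclic_diff n a b \<in> D"
      unfolding E_def by blast
    then have "i = a \<and> j = b \<or> i = b \<and> j = a" using hinj that unfolding doubleton_eq_iff by blast
    then show "cyclic_diff n i j \<in> D" using ab rev by blast
  qed (use that in \<open>auto simp: E_def\<close>)
  have nb: "neighbours E (h i) = h ` {j \<in> {0..<n}. cyclic_diff n i j \<in> D}" if i: "i < n" for i
  proof (intro set_eqI iffI)
    fix w assume w: "w \<in> neighbours E (h i)"
    then have "w \<in> S" using neighbours_subset[OF sub] by blast
    then obtain j where "j < n" "w = h j" using bij_betw_imp_surj_on[OF h] by auto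
    then show "w \<in> h ` {j \<in> {0..<n}. cyclic_diff n i j \<in> D}"
      using w mem[OF i] by (auto simp: neighbours_def)
  qed (use mem[OF i] in \<open>auto simp: neighbours_def\<close>)
  have "card (neighbours E v) = d" if v: "v \<in> S" for v
  proof -
    obtain i where i: "i < n" "v = h i" using v bij_betw_imp_surj_on[OF h] by auto
    have "inj_on h {j \<in> {0..<n}. cyclic_diff n i j \<in> D}"
      using bij_betw_imp_inj_on[OF h] by (rule inj_on_subset) auto
    then show ?thesis using i card_cyclic_diff(1)[of i n D] D by (simp add: nb card_image)
  qed
  then have "E \<in> reg_graphs S d" using sub by (simp add: reg_graphs_iff)
  then show ?thesis by blast
qed

text \<open>For odd \<open>n\<close> the degree must be even and the circulant graph applies. For
  even \<open>n\<close> a regular bipartite graph between two halves of \<open>S\<close> works,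
  because \<open>d\<close> is below \<open>n / 2\<close>.\<close>

lemma reg_graphs_nonempty:
  assumes fin: "finite S" and card: "card S = n" and even: "even (n * d)" and d: "2 * d < n"
  shows "reg_graphs S d \<noteq> {}"
proof (cases "even n")
  case False
  then show ?thesis using reg_graphs_nonempty_odd[OF fin card] even d by simp
next
  case True
  then obtain m where m: "n = 2 * m" by blast
  then obtain T where T: "T \<subseteq> S" "card T = m"
    using card by (metis le_add1 mult_2 obtain_subset_with_card_n)
  have "card (S - T) = m" using T card m fin by (simp add: card_Diff_subset finite_subset)
  then obtain E where E: "E \<in> bip_reg_graphs T (S - T) d"
    using bip_reg_graphs_nonempty[of T "S - T" m d] T fin d m by (auto dest: finite_subset)
  have "T \<union> (S - T) = S" using T by auto
  then have "E \<in> reg_graphs S d"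
    using E cross_pairs_subset[of T "S - T"] by (auto simp: bip_reg_graphs_iff reg_graphs_iff)
  then show ?thesis by blast
qed

section \<open>The model as a uniform choice among block graphs\<close>

lemma pair_pmf_of_set:
  assumes "finite A" "A \<noteq> {}" "finite B" "B \<noteq> {}"
  shows "pair_pmf (pmf_of_set A) (pmf_of_set B) = pmf_of_set (A \<times> B)"
proof (rule pmf_eqI)
  fix x :: "'a \<times> 'b"
  show "pmf (pair_pmf (pmf_of_set A) (pmf_of_set B)) x = pmf (pmf_of_set (A \<times> B)) x"
    using assms by (cases x) (auto simp: pmf_pair pmf_of_set card_cartesian_product indicator_def)
qed

lemma finite_equipartitions: "finite (equipartitions n)"
  by (rule finite_subset[of _ "Pow (vertices n)"]) (auto simp: equipartitions_def vertices_def)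

lemma equipartitions_nonempty: "equipartitions n \<noteq> {}"
proof -
  have "{0..<n} \<in> equipartitions n" by (auto simp: equipartitions_def vertices_def)
  then show ?thesis by blast
qed

lemma card_compl_equipartition:
  assumes "A \<in> equipartitions n"
  shows "card (vertices n - A) = n"
proof -
  have "A \<subseteq> vertices n" "finite (vertices n)" using assms by (auto simp: equipartitions_def vertices_def)
  then show ?thesis using assms by (simp add: card_Diff_subset finite_subset equipartitions_def) (simp add: vertices_def)
qed

text \<open>Ensures that each \<open>pmf_of_set\<close> in the model is a genuine uniform
  distribution, which presupposes a nonempty set.\<close>

lemma SBM_factors_nonempty:
  assumes A: "A \<in> equipartitions n" and "even (n * d1)" "2 * d1 < n" "d2 \<le> n"
  shows "reg_graphs A d1 \<noteq> {}" "reg_graphs (vertices n - A) d1 \<noteq> {}" "bip_reg_graphs A (vertices n - A) d2 \<noteq> {}"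
proof -
  have sub: "A \<subseteq> vertices n" and card: "card A = n" using A by (auto simp: equipartitions_def)
  have fin: "finite A" "finite (vertices n - A)" using sub by (auto simp: vertices_def dest: finite_subset)
  show "reg_graphs A d1 \<noteq> {}"
    using assms by (intro reg_graphs_nonempty[OF fin(1) card])
  show "reg_graphs (vertices n - A) d1 \<noteq> {}"
    using assms by (intro reg_graphs_nonempty[OF fin(2) card_compl_equipartition[OF A]])
  show "bip_reg_graphs A (vertices n - A) d2 \<noteq> {}"
    using assms by (intro bip_reg_graphs_nonempty[OF fin card card_compl_equipartition[OF A]]) auto
qed

text \<open>Three independent uniform choices are uniform on the product, and the union bijection
  carries this to the uniform law on block graphs.\<close>

lemma SBM_eq_block_graphs:
  assumes n: "even (n * d1)" "2 * d1 < n" "d2 \<le> n"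
  shows "SBM n d1 d2 = pmf_of_set (equipartitions n) \<bind>
    (\<lambda>A. map_pmf (Pair A) (pmf_of_set (block_graphs (vertices n) A d1 d2)))"
  unfolding SBM_def
proof (rule bind_pmf_cong[OF refl])
  fix A assume "A \<in> set_pmf (pmf_of_set (equipartitions n))"
  then have A: "A \<in> equipartitions n" by (simp add: finite_equipartitions equipartitions_nonempty)
  let ?R1 = "reg_graphs A d1" and ?R2 = "reg_graphs (vertices n - A) d1" and ?R3 = "bip_reg_graphs A (vertices n - A) d2"
  have sub: "A \<subseteq> vertices n" using A by (simp add: equipartitions_def)
  have finV: "finite (vertices n)" by (simp add: vertices_def)
  note ne = SBM_factors_nonempty[OF A n]
  have bij: "bij_betw (\<lambda>(E1, E2, E3). E1 \<union> E2 \<union> E3) (?R1 \<times> ?R2 \<times> ?R3) (block_graphs (vertices n) A d1 d2)"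
    by (rule bij_betw_block_graphs[OF sub])
  have "finite (?R1 \<times> ?R2 \<times> ?R3)" using bij finV bij_betw_finite finite_block_graphs by blast
  \<comment> \<open>Finiteness passes from the product to its factors because all of them are
    nonempty.\<close>
  moreover from this have "finite ?R1" "finite ?R2" "finite ?R3" "finite (?R2 \<times> ?R3)"
    using ne by (auto simp: finite_cartesian_product_iff)
  ultimately have "pmf_of_set (block_graphs (vertices n) A d1 d2)
    = map_pmf (\<lambda>(E1, E2, E3). E1 \<union> E2 \<union> E3) (pair_pmf (pmf_of_set ?R1) (pair_pmf (pmf_of_set ?R2) (pmf_of_set ?R3)))"
    using ne by (subst map_pmf_of_set_bij_betw[OF bij, symmetric]) (simp_all add: pair_pmf_of_set)
  then show "pmf_of_set ?R1 \<bind> (\<lambda>E1. pmf_of_set ?R2 \<bind> (\<lambda>E2. pmf_of_set ?R3 \<bind> (\<lambda>E3. return_pmf (A, E1 \<union> E2 \<union> E3))))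
    = map_pmf (Pair A) (pmf_of_set (block_graphs (vertices n) A d1 d2))"
    by (simp add: pair_pmf_def map_pmf_def bind_assoc_pmf bind_return_pmf)
qed

lemma prob_bind_pmf_le:
  assumes "\<And>x. x \<in> set_pmf M \<Longrightarrow> measure_pmf.prob (f x) X \<le> b" and "b \<ge> 0"
  shows "measure_pmf.prob (bind_pmf M f) X \<le> b"
proof -
  have "emeasure (bind_pmf M f) X = (\<integral>\<^sup>+x. emeasure (f x) X \<partial>M)" by (rule emeasure_bind_pmf)
  also have "\<dots> \<le> (\<integral>\<^sup>+x. ennreal b \<partial>M)"
    by (rule nn_integral_mono_AE)
      (use assms in \<open>auto simp: AE_measure_pmf_iff measure_pmf.emeasure_eq_measure ennreal_leI\<close>)
  also have "\<dots> = ennreal b" by simp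
  finally show ?thesis using assms(2) by (simp add: measure_pmf.emeasure_eq_measure)
qed

section \<open>Recovery\<close>

lemma sparsity_radius_bounds:
  assumes "d > 0"
  shows "sparsity_radius d > 0" "sparsity_radius d \<le> 1"
proof -
  have "real d ^ 2 \<ge> 1" using assms by (intro one_le_power) simp
  then have ge: "12 * (4 * real d ^ 2) \<ge> 1" "2 * (4 * real d ^ 2) \<ge> 1" by linarith+
  then have "(12 * (4 * real d ^ 2)) ^ 4 \<ge> 1" by (intro one_le_power)
  then have "(12 * (4 * real d ^ 2)) ^ 4 * (2 * (4 * real d ^ 2)) \<ge> 1" using ge(2) by (rule mult_ge1_I)
  moreover have "1 / (256 * x) > 0" "1 / (256 * x) \<le> 1" if "x \<ge> 1" for x :: real
    using that by (simp_all add: divide_simps)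
  ultimately show "sparsity_radius d > 0" "sparsity_radius d \<le> 1" unfolding sparsity_radius_def by blast+
qed

lemma card_sym_diff_equipartition:
  assumes \<A>: "\<A> \<in> equipartitions n" and A: "A \<subseteq> vertices n"
  shows "card (sym_diff A \<A>) + card (A \<inter> \<A>) + card ((vertices n - A) \<inter> (vertices n - \<A>)) = 2 * n"
proof -
  let ?V = "vertices n"
  have fin: "finite ?V" and \<A>V: "\<A> \<subseteq> ?V" using \<A> by (auto simp: equipartitions_def vertices_def)
  have finA: "finite A" "finite \<A>" using fin A \<A>V finite_subset by auto
  have "?V = sym_diff A \<A> \<union> (A \<inter> \<A>) \<union> ((?V - A) \<inter> (?V - \<A>))" using A \<A>V by blast
  also have "card \<dots> = card (sym_diff A \<A>) + card (A \<inter> \<A>) + card ((?V - A) \<inter> (?V - \<A>))"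
    using fin finA by (subst card_Un_disjoint; (subst card_Un_disjoint)?) auto
  finally show ?thesis by (simp add: vertices_def)
qed

text \<open>Each overlap misses less than \<open>\<eta> / 4 * n\<close> vertices, so the initial
  error is at most \<open>\<eta> / 2 * n\<close>. Sets of up to twice that size then stay within the
  range \<open>\<eta> * n\<close> where sparsity is known.\<close>

lemma recovery_of_sparse:
  fixes d1 :: nat
  defines "\<eta> \<equiv> sparsity_radius d1"
  assumes \<A>: "\<A> \<in> equipartitions n" and E: "E \<in> block_graphs (vertices n) \<A> d1 d2"
    and d: "d1 > d2 + 4" and n: "n \<ge> 3" and A: "A \<subseteq> vertices n"
    and sparse: "\<not> (\<exists>U\<subseteq>vertices n. U \<noteq> {} \<and> real (card U) \<le> \<eta> * real n \<and> 5 * card U < 4 * card {e \<in> E. e \<subseteq> U})"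
    and close: "real (card (A \<inter> \<A>)) > (1 - \<eta> / 4) * real n"
      "real (card ((vertices n - A) \<inter> (vertices n - \<A>))) > (1 - \<eta> / 4) * real n"
  shows "\<exists>t. real t \<le> (1 / ln (6 / 5) + 1) * ln (real n) \<and> (majority_step (vertices n) E tie ^^ t) A = \<A>"
proof -
  let ?S = "sym_diff A \<A>"
  have "real (card ?S) + real (card (A \<inter> \<A>)) + real (card ((vertices n - A) \<inter> (vertices n - \<A>))) = 2 * real n"
    using card_sym_diff_equipartition[OF \<A> A] by (metis of_nat_add of_nat_mult of_nat_numeral)
  then have S: "real (card ?S) \<le> \<eta> / 2 * real n" using close by (simp add: algebra_simps)
  have "\<eta> \<le> 1" using sparsity_radius_bounds(2) d by (simp add: \<eta>_def)
  then have "\<eta> / 2 * real n \<le> 1 * real n" by (intro mult_right_mono) auto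
  then have Sn: "real (card ?S) \<le> real n" using S by simp
  show ?thesis
  proof (rule majority_converges[OF _ E d _ A n Sn])
    show "finite (vertices n)" "\<A> \<subseteq> vertices n" using \<A> by (auto simp: vertices_def equipartitions_def)
    fix U assume U: "U \<subseteq> vertices n" "card U \<le> 2 * card ?S"
    have "real (card U) \<le> \<eta> * real n" using U(2) S by linarith
    moreover have "{e \<in> E. e \<subseteq> {}} = {}" using E by (auto simp: block_graphs_def pairs_def)
    ultimately show "4 * card {e \<in> E. e \<subseteq> U} \<le> 5 * card U"
      using sparse U(1) by (cases "U = {}") (auto simp: not_less)
  qed
qed

text \<open>Turns the count of dense graphs into a probability: the bound holds conditionally on
  every equipartition, hence also on average.\<close>

lemma prob_SBM_le:
  fixes d1 :: nat
  defines "\<eta> \<equiv> sparsity_radius d1"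
  assumes d: "3 \<le> d2" "d2 \<le> d1" and n: "even (n * d1)" "n \<ge> 4 * d1 * (2 * d1 + 1)"
    and X: "\<And>\<A> E. \<A> \<in> equipartitions n \<Longrightarrow> E \<in> block_graphs (vertices n) \<A> d1 d2 \<Longrightarrow> (\<A>, E) \<in> X \<Longrightarrow>
      \<exists>U\<subseteq>vertices n. U \<noteq> {} \<and> real (card U) \<le> \<eta> * real n \<and> 5 * card U < 4 * card {e \<in> E. e \<subseteq> U}"
  shows "measure_pmf.prob (SBM n d1 d2) X \<le> 1 / (4 * \<eta>) / real n"
proof -
  \<comment> \<open>The size condition from the switching estimate also makes \<open>n\<close> large
    enough for the regular graphs to exist.\<close>
  have "2 * d1 + 1 \<le> (4 * d1) * (2 * d1 + 1)" using d by (cases d1) auto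
  then have n': "2 * d1 < n" "d2 \<le> n" using n(2) d by linarith+
  have \<eta>: "\<eta> > 0" using sparsity_radius_bounds d by (simp add: \<eta>_def)
  have finV: "finite (vertices n)" by (simp add: vertices_def)
  show ?thesis
    unfolding SBM_eq_block_graphs[OF n(1) n']
  proof (rule prob_bind_pmf_le)
    fix \<A> assume "\<A> \<in> set_pmf (pmf_of_set (equipartitions n))"
    then have \<A>: "\<A> \<in> equipartitions n" by (simp add: finite_equipartitions equipartitions_nonempty)
    then have sub: "\<A> \<subseteq> vertices n" and card: "card \<A> = n" by (auto simp: equipartitions_def)
    let ?G = "block_graphs (vertices n) \<A> d1 d2"
    have fin: "finite ?G" using finV by (rule finite_block_graphs)
    have ne: "?G \<noteq> {}"
      using bij_betw_imp_surj_on[OF bij_betw_block_graphs[OF sub, of d1 d2]] SBM_factors_nonempty[OF \<A> n(1) n'] by auto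
    have pos: "card ?G > 0" using fin ne by (simp add: card_gt_0_iff)
    let ?B = "{E \<in> ?G. \<exists>U\<subseteq>vertices n. U \<noteq> {} \<and> real (card U) \<le> \<eta> * real n \<and> 5 * card U < 4 * card {e \<in> E. e \<subseteq> U}}"
    have "measure_pmf.prob (map_pmf (Pair \<A>) (pmf_of_set ?G)) X = real (card (?G \<inter> Pair \<A> -` X)) / real (card ?G)"
      using measure_pmf_of_set[OF ne fin] by simp
    also have "\<dots> \<le> real (card ?B) / real (card ?G)"
    proof (intro divide_right_mono of_nat_mono card_mono)
      show "?G \<inter> Pair \<A> -` X \<subseteq> ?B" using X[OF \<A>] by blast
    qed (use fin in auto)
    also have "\<dots> \<le> 1 / (4 * \<eta>) / real n"
    proof -
      have "real (card ?B) \<le> 1 / (4 * \<eta>) / real n * real (card ?G)"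
        using card_dense_le[OF finV sub card card_compl_equipartition[OF \<A>] d n(2)] by (simp add: \<eta>_def)
      then show ?thesis using pos by (simp add: pos_divide_le_eq)
    qed
    finally show "measure_pmf.prob (map_pmf (Pair \<A>) (pmf_of_set ?G)) X \<le> 1 / (4 * \<eta>) / real n" .
  qed (use \<eta> in simp)
qed

theorem theorem1p7:
  fixes d1 :: nat
  assumes "d1 \<ge> 3"
  shows "\<exists>\<epsilon>::real. \<epsilon> > 0 \<and> (\<exists>C::real. C > 0 \<and>
    (\<forall>(d2::nat) (tie::nat \<Rightarrow> bool). 3 \<le> d2 \<longrightarrow> d1 > d2 + 4 \<longrightarrow>
      ((\<lambda>n. measure_pmf.prob (SBM n d1 d2)
          {(\<A>, E). \<forall>A. A \<subseteq> vertices n \<longrightarrow>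
              real (card (A \<inter> \<A>)) > (1 - \<epsilon>) * real n \<longrightarrow>
              real (card ((vertices n - A) \<inter> (vertices n - \<A>))) > (1 - \<epsilon>) * real n \<longrightarrow>
              (\<exists>t::nat. real t \<le> C * ln (real n) \<and>
                 (majority_step (vertices n) E tie ^^ t) A = \<A>)})
       \<longlongrightarrow> 1) (inf sequentially (principal {n. even (n * d1)}))))"
proof -
  define \<eta> where "\<eta> = sparsity_radius d1"
  have \<eta>: "\<eta> > 0" using sparsity_radius_bounds assms by (simp add: \<eta>_def)
  \<comment> \<open>The reciprocal of \<open>ln (6 / 5)\<close> comes from the contraction factor
    \<open>5 / 6\<close>; neither \<open>C\<close> nor \<open>\<eta>\<close> involves
    \<open>d2\<close> or \<open>tie\<close>.\<close>
  define C :: real where "C = 1 / ln (6 / 5) + 1"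
  have C: "C > 0" by (simp add: C_def add_pos_pos)
  define good where "good = (\<lambda>n tie. {(\<A>, E). \<forall>A. A \<subseteq> vertices n \<longrightarrow>
              real (card (A \<inter> \<A>)) > (1 - \<eta> / 4) * real n \<longrightarrow>
              real (card ((vertices n - A) \<inter> (vertices n - \<A>))) > (1 - \<eta> / 4) * real n \<longrightarrow>
              (\<exists>t::nat. real t \<le> C * ln (real n) \<and>
                 (majority_step (vertices n) E tie ^^ t) A = \<A>)})"
  have "((\<lambda>n. measure_pmf.prob (SBM n d1 d2) (good n tie)) \<longlongrightarrow> 1) (inf sequentially (principal {n. even (n * d1)}))"
    if d: "3 \<le> d2" "d1 > d2 + 4" for d2 :: nat and tie :: "nat \<Rightarrow> bool"
  proof (rule tendsto_sandwich)
    let ?F = "inf sequentially (principal {n. even (n * d1)})"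
    have lower: "1 - 1 / (4 * \<eta>) / real n \<le> measure_pmf.prob (SBM n d1 d2) (good n tie)"
      if n: "n \<ge> 4 * d1 * (2 * d1 + 1)" "even (n * d1)" for n
    proof -
      have "3 \<le> 4 * d1 * (2 * d1 + 1)" using d by (cases d1) auto
      then have n3: "n \<ge> 3" using n by linarith
      \<comment> \<open>Failure of recovery forces a small dense vertex set, an event of probability
        \<open>O(1 / n)\<close>.\<close>
      have "measure_pmf.prob (SBM n d1 d2) (- good n tie) \<le> 1 / (4 * \<eta>) / real n"
        unfolding \<eta>_def
      proof (rule prob_SBM_le[OF d(1) _ n(2) n(1)])
        fix \<A> E assume \<A>: "\<A> \<in> equipartitions n" and E: "E \<in> block_graphs (vertices n) \<A> d1 d2"
          and bad: "(\<A>, E) \<in> - good n tie"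
        show "\<exists>U\<subseteq>vertices n. U \<noteq> {} \<and> real (card U) \<le> sparsity_radius d1 * real n \<and> 5 * card U < 4 * card {e \<in> E. e \<subseteq> U}"
        proof (rule ccontr)
          assume "\<not> ?thesis"
          then have "(\<A>, E) \<in> good n tie"
            using recovery_of_sparse[OF \<A> E d(2) n3] unfolding good_def \<eta>_def C_def by simp
          then show False using bad by simp
        qed
      qed (use d in simp)
      moreover have "measure_pmf.prob (SBM n d1 d2) (- good n tie) = 1 - measure_pmf.prob (SBM n d1 d2) (good n tie)"
        using measure_pmf.prob_compl[of "good n tie" "SBM n d1 d2"] by (simp add: Compl_eq_Diff_UNIV)
      ultimately show ?thesis by linarith
    qed
    show "\<forall>\<^sub>F n in ?F. 1 - 1 / (4 * \<eta>) / real n \<le> measure_pmf.prob (SBM n d1 d2) (good n tie)"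
      unfolding eventually_inf_principal
      using eventually_ge_at_top[of "4 * d1 * (2 * d1 + 1)"] by eventually_elim (use lower in simp)
    show "\<forall>\<^sub>F n in ?F. measure_pmf.prob (SBM n d1 d2) (good n tie) \<le> 1" by simp
    have "((\<lambda>n. 1 - 1 / (4 * \<eta>) / real n) \<longlongrightarrow> 1 - 0) sequentially"
      by (intro tendsto_diff tendsto_const lim_const_over_n)
    then show "((\<lambda>n. 1 - 1 / (4 * \<eta>) / real n) \<longlongrightarrow> 1) ?F"
      by (simp add: tendsto_mono[OF inf_le1])
    show "((\<lambda>n. 1) \<longlongrightarrow> (1::real)) ?F" by simp
  qed
  \<comment> \<open>The witness for \<open>\<epsilon>\<close> is \<open>\<eta> / 4\<close>, the
    closeness that recovery asks of the initial partition.\<close>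
  then show ?thesis
    using \<eta> C unfolding good_def by (intro exI[of _ "\<eta> / 4"] conjI exI[of _ C] allI impI) auto
qed

end
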